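(* For all $A,B\subseteq\mathbb{N}$, we have $\tilde{\mathbf{c}}_A \leq \tilde{\mathbf{c}}_B$ (in the T3 degrees) if and only if $[B]_{\mathrm{T0}} \leq [A]_{\mathrm{T0}}$ (equivalently: $\tilde{\mathbf{d}}_B \leq \tilde{\mathbf{d}}_A$). Thus the mapping $\operatorname{coT}\colon [A]_{\mathrm{T0}} \mapsto \tilde{\mathbf{c}}_A$ is a well-defined injection from $\mathscr{D}_{\mathrm{T0}}^{\mathrm{op}}$ (the set of Turing degrees with the opposite order) to $\mathscr{D}_{\mathrm{T3}}$, which preserves and reflects the order.
   Context: Oracles. A T0 oracle is a total function $\mathbb{N}\to\mathbb{N}$; a T1 oracle is a partial function from $\mathbb{N}$ to $\mathbb{N}$; a T2 oracle is a partial function from $\mathbb{N}$ to $\mathcal{P}(\mathbb{N})$; a T3 oracle is a total function $\mathbb{N}\to\mathcal{P}(\mathcal{P}(\mathbb{N}))$; a basic (T3) oracle is an element of $\mathcal{P}(\mathcal{P}(\mathbb{N}))$. Identifications: a T0 oracle is a T1 oracle that happens to be total; a T1 oracle $g$ is identified with the T2 oracle $n\mapsto\{g(n)\}$ (undefined where $g$ is); a T2 oracle $g$ is identified with the T3 oracle $n\mapsto\{g(n)\}$ if $g(n)$ is defined and $n\mapsto\varnothing$ otherwise; a basic oracle is identified with the corresponding constant T3 oracle. Reduction game of $f$ to $g$ (for T3 oracles $f,g$). Players Arthur and Nimue are allied against Merlin. The initial configuration is any $m\in\mathbb{N}$ together with a set $F\in f(m)$; Arthur sees only $m$, while Nimue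 and Merlin see both. Arthur, Nimue, Merlin then play in turn, repeatedly. At his turn Arthur either declares a final value $u\in\mathbb{N}$, ending the game (Arthur and Nimue win iff $u\in F$), or queries the oracle at some $n\in\mathbb{N}$. If $g(n)=\varnothing$, Arthur and Nimue lose immediately; otherwise Nimue chooses $G\in g(n)$ (seen by Merlin, not by Arthur). If $G=\varnothing$, Merlin loses immediately; otherwise Merlin chooses $v\in G$, which everyone sees, and it is Arthur's turn again. If the game never ends, Merlin wins. An Arthur strategy is a partial computable function taking $m$ and the finite sequence of Merlin's moves so far to Arthur's next move (if it is undefined or malformed, Arthur and Nimue lose); a Nimue strategy is an arbitrary function of the initial configuration and of all past moves of Arthur and Merlin. A pair of such strategies is winning if Arthur and Nimue win for every initial configuration and all moves of Merlin. One says $f$ is reducible to $g$ if a winning Arthur+Nimue strategy exists. This is a preorder; the T3 degrees $\mathscr{D}_{\mathrm{T3}}$ are the poset quotient, with order $\leq$. The T0, T1, T2, basic T3 degrees are the T3 degrees of T0, T1, T2, basic oracles, with the induced order; $\mathscr{D}_{\mathrm{T0}}$ is exactly the set of Turing degrees with its usual order, and $[A]_{\mathrm{T0}}$ is the Turing degree of (the characteristic function of) $A\subseteq\mathbb{N}$. For $P,Q\subseteq\mathbb{N}$ nonempty and disjoint, $\mathbf{d}_{P,Q}$ (the decoding degree) is the T1 degree of the partial function equal to $0$ on $P$, $1$ on $Q$, undefined elsewhere; $\mathbf{c}_{P,Q}$ (the coding degree) is the T3 degree of the basic oracle $\{P,Q\}$. $\varphi_e^A$ is the $e$-th partial computable function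 with oracle $A$ (numbering of oracle programs independent of the oracle). For $A\subseteq\mathbb{N}$ and $i\in\{0,1\}$, $H_i^A := \{e \mid \varphi_e^A(0)\text{ is defined and equals } i\}$. Set $\tilde{\mathbf{d}}_A := \mathbf{d}_{H_0^A,H_1^A}$ and $\tilde{\mathbf{c}}_A := \mathbf{c}_{H_0^A,H_1^A}$ (the co-Turing degree of $A$). *)

theory Defs
  imports "HOL-Library.Nat_Bijection"
begin

section \<open>Partial computable functions with an oracle\<close>

text \<open>
  Partial recursive functions are rendered as unary functions on \<open>nat\<close>, tuples being coded by
  \<^const>\<open>prod_encode\<close>. A program does not mention the oracle it is run with.
\<close>

datatype prog =
    PZero
  | PSucc
  | PFst
  | PSnd
  | POracle
  | PPair prog prog
  | PComp prog prog
  | PRec prog prog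
  | PMu prog

text \<open>
  \<open>PRec\<close> is primitive recursion: \<open>h(a,0) = p(a)\<close>, \<open>h(a,k+1) = q(a,(k,h(a,k)))\<close>.
  \<open>PMu\<close> is minimization: the least \<open>n\<close> with \<open>p(x,n) = 0\<close>, provided that \<open>p(x,k)\<close> is
  defined (and nonzero) for all \<open>k < n\<close>.
\<close>

primrec run :: "(nat \<Rightarrow> nat) \<Rightarrow> prog \<Rightarrow> nat \<Rightarrow> nat option" where
  "run g PZero = (\<lambda>x. Some 0)"
| "run g PSucc = (\<lambda>x. Some (Suc x))"
| "run g PFst = (\<lambda>x. Some (fst (prod_decode x)))"
| "run g PSnd = (\<lambda>x. Some (snd (prod_decode x)))"
| "run g POracle = (\<lambda>x. Some (g x))"
| "run g (PPair p q) =
     (\<lambda>x. Option.bind (run g p x) (\<lambda>y. Option.bind (run g q x) (\<lambda>z. Some (prod_encode (y, z)))))"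
| "run g (PComp p q) = (\<lambda>x. Option.bind (run g q x) (run g p))"
| "run g (PRec p q) =
     (\<lambda>x. rec_nat (run g p (fst (prod_decode x)))
        (\<lambda>k r. Option.bind r (\<lambda>y. run g q (prod_encode (fst (prod_decode x), prod_encode (k, y)))))
        (snd (prod_decode x)))"
| "run g (PMu p) =
     (\<lambda>x. if (\<exists>n. run g p (prod_encode (x, n)) = Some 0
                 \<and> (\<forall>k<n. run g p (prod_encode (x, k)) \<noteq> None))
          then Some (LEAST n. run g p (prod_encode (x, n)) = Some 0)
          else None)"

primrec prog_encode :: "prog \<Rightarrow> nat" where
  "prog_encode PZero = 0"
| "prog_encode PSucc = 1"
| "prog_encode PFst = 2"
| "prog_encode PSnd = 3"
| "prog_encode POracle = 4"
| "prog_encode (PPair p q) = 5 + 4 * prod_encode (prog_encode p, prog_encode q)"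
| "prog_encode (PComp p q) = 6 + 4 * prod_encode (prog_encode p, prog_encode q)"
| "prog_encode (PRec p q) = 7 + 4 * prod_encode (prog_encode p, prog_encode q)"
| "prog_encode (PMu p) = 8 + 4 * prog_encode p"

lemma inj_prog_encode: "inj prog_encode"
proof (rule injI)
  fix p q :: prog
  show "prog_encode p = prog_encode q \<Longrightarrow> p = q"
  proof (induction p arbitrary: q)
    case PZero then show ?case by (cases q) auto
  next
    case PSucc then show ?case by (cases q) auto
  next
    case PFst then show ?case by (cases q) auto
  next
    case PSnd then show ?case by (cases q) auto
  next
    case POracle then show ?case by (cases q) auto
  next
    case (PPair a b) from PPair(3) show ?case
      by (cases q; simp; (presburger | blast intro: PPair.IH))
  next
    case (PComp a b) from PComp(3) show ?case
      by (cases q; simp; (presburger | blast intro: PComp.IH))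
  next
    case (PRec a b) from PRec(3) show ?case
      by (cases q; simp; (presburger | blast intro: PRec.IH))
  next
    case (PMu a) from PMu(2) show ?case
      by (cases q; simp; (presburger | blast intro: PMu.IH))
  qed
qed

lemma surj_prog_encode: "surj prog_encode"
proof -
  have "e \<in> range prog_encode" for e
  proof (induction e rule: less_induct)
    case (less e)
    show ?case
    proof (cases "e < 5")
      case True
      then consider "e = 0" | "e = 1" | "e = 2" | "e = 3" | "e = 4" by linarith
      then show ?thesis by cases (metis prog_encode.simps rangeI)+
    next
      case False
      define d where "d = (e - 5) div 4"
      obtain x y where xy: "prod_decode d = (x, y)" by (cases "prod_decode d")
      then have dxy: "d = prod_encode (x, y)" by (metis prod_decode_inverse)
      have "x \<le> d" "y \<le> d" "d < e"
        using False dxy le_prod_encode_1 le_prod_encode_2 by (auto simp: d_def)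
      then have "x \<in> range prog_encode" "y \<in> range prog_encode" "d \<in> range prog_encode"
        using less.IH by (meson le_less_trans)+
      then obtain p q r where pqr: "x = prog_encode p" "y = prog_encode q" "d = prog_encode r"
        by blast
      have "e = 5 + 4 * d \<or> e = 6 + 4 * d \<or> e = 7 + 4 * d \<or> e = 8 + 4 * d"
        using False unfolding d_def by presburger
      then have "e = prog_encode (PPair p q) \<or> e = prog_encode (PComp p q)
          \<or> e = prog_encode (PRec p q) \<or> e = prog_encode (PMu r)"
        using pqr dxy by auto
      then show ?thesis by blast
    qed
  qed
  then show ?thesis by blast
qed

theorem bij_prog_encode: "bij prog_encode"
  using inj_prog_encode surj_prog_encode by (simp add: bij_def)

definition char_fun :: "nat set \<Rightarrow> nat \<Rightarrow> nat" where
  "char_fun A n = (if n \<in> A then 1 else 0)"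

definition phi :: "nat set \<Rightarrow> nat \<Rightarrow> nat \<Rightarrow> nat option" where
  "phi A e = run (char_fun A) (inv prog_encode e)"

text \<open>Computability without an oracle is computability with the oracle \<open>{}\<close>.\<close>

definition partial_computable :: "(nat \<Rightarrow> nat option) \<Rightarrow> bool" where
  "partial_computable f \<longleftrightarrow> (\<exists>e. f = phi {} e)"


section \<open>Oracles\<close>

type_synonym T0_oracle = "nat \<Rightarrow> nat"
type_synonym T1_oracle = "nat \<Rightarrow> nat option"
type_synonym T2_oracle = "nat \<Rightarrow> nat set option"
type_synonym T3_oracle = "nat \<Rightarrow> nat set set"
type_synonym basic_oracle = "nat set set"

definition T0_to_T1 :: "T0_oracle \<Rightarrow> T1_oracle" where
  "T0_to_T1 g n = Some (g n)"

definition T1_to_T2 :: "T1_oracle \<Rightarrow> T2_oracle" where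
  "T1_to_T2 g n = map_option (\<lambda>v. {v}) (g n)"

definition T2_to_T3 :: "T2_oracle \<Rightarrow> T3_oracle" where
  "T2_to_T3 g n = (case g n of None \<Rightarrow> {} | Some G \<Rightarrow> {G})"

definition basic_to_T3 :: "basic_oracle \<Rightarrow> T3_oracle" where
  "basic_to_T3 \<G> n = \<G>"

definition T1_to_T3 :: "T1_oracle \<Rightarrow> T3_oracle" where
  "T1_to_T3 g = T2_to_T3 (T1_to_T2 g)"

definition T0_to_T3 :: "T0_oracle \<Rightarrow> T3_oracle" where
  "T0_to_T3 g = T1_to_T3 (T0_to_T1 g)"


section \<open>The reduction game\<close>

datatype arthur_move = Declare nat | Query nat

text \<open>
  A strategy for Arthur maps \<open>m\<close> and the list of Merlin's moves so far (in chronological order)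
  to his next move, \<open>None\<close> meaning that it is undefined.
  A strategy for Nimue maps the initial configuration \<open>m\<close>, \<open>F\<close>, the list of Arthur's queries
  (ending with the one she has to react to) and the list of Merlin's moves to a set \<open>G\<close>.
\<close>

type_synonym arthur_strategy = "nat \<Rightarrow> nat list \<Rightarrow> arthur_move option"
type_synonym nimue_strategy = "nat \<Rightarrow> nat set \<Rightarrow> nat list \<Rightarrow> nat list \<Rightarrow> nat set"

fun move_encode :: "arthur_move \<Rightarrow> nat" where
  "move_encode (Declare u) = sum_encode (Inl u)"
| "move_encode (Query n) = sum_encode (Inr n)"

definition computable_strategy :: "arthur_strategy \<Rightarrow> bool" where
  "computable_strategy \<alpha> \<longleftrightarrow>
     (\<exists>f. partial_computable f \<and>
        (\<forall>m vs. f (prod_encode (m, list_encode vs)) = map_option move_encode (\<alpha> m vs)))"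

text \<open>
  \<open>reachable g \<alpha> \<nu> m F qs vs\<close>: in the game with oracle \<open>g\<close> started at \<open>m\<close>, \<open>F\<close>, if Arthur and
  Nimue play \<open>\<alpha>\<close> and \<open>\<nu>\<close>, it can come to be Arthur's turn after he has made the queries \<open>qs\<close>
  and Merlin has answered \<open>vs\<close>.
\<close>

inductive reachable ::
  "T3_oracle \<Rightarrow> arthur_strategy \<Rightarrow> nimue_strategy \<Rightarrow> nat \<Rightarrow> nat set \<Rightarrow> nat list \<Rightarrow> nat list \<Rightarrow> bool"
  for g :: T3_oracle and \<alpha> :: arthur_strategy and \<nu> :: nimue_strategy
    and m :: nat and F :: "nat set" where
  start: "reachable g \<alpha> \<nu> m F [] []"
| step: "\<lbrakk>reachable g \<alpha> \<nu> m F qs vs; \<alpha> m vs = Some (Query n);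
          \<nu> m F (qs @ [n]) vs \<in> g n; v \<in> \<nu> m F (qs @ [n]) vs\<rbrakk>
         \<Longrightarrow> reachable g \<alpha> \<nu> m F (qs @ [n]) (vs @ [v])"

text \<open>
  At Arthur's turn, Arthur and Nimue avoid losing at once if Arthur makes a correct declaration,
  or makes a query to which Nimue responds legally (which is impossible if \<open>g n = {}\<close>). If she
  responds with the empty set, Merlin has no move and loses: no further position is reached.
\<close>

definition no_immediate_loss ::
  "T3_oracle \<Rightarrow> arthur_strategy \<Rightarrow> nimue_strategy \<Rightarrow> nat \<Rightarrow> nat set \<Rightarrow> nat list \<Rightarrow> nat list \<Rightarrow> bool"
  where
  "no_immediate_loss g \<alpha> \<nu> m F qs vs \<longleftrightarrow>
     (case \<alpha> m vs of
        None \<Rightarrow> False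
      | Some (Declare u) \<Rightarrow> u \<in> F
      | Some (Query n) \<Rightarrow> \<nu> m F (qs @ [n]) vs \<in> g n)"

definition infinite_play ::
  "T3_oracle \<Rightarrow> arthur_strategy \<Rightarrow> nimue_strategy \<Rightarrow> nat \<Rightarrow> nat set \<Rightarrow> (nat \<Rightarrow> nat) \<Rightarrow> (nat \<Rightarrow> nat) \<Rightarrow> bool"
  where
  "infinite_play g \<alpha> \<nu> m F q v \<longleftrightarrow>
     (\<forall>k. reachable g \<alpha> \<nu> m F (map q [0..<k]) (map v [0..<k]))"

definition winning :: "T3_oracle \<Rightarrow> T3_oracle \<Rightarrow> arthur_strategy \<Rightarrow> nimue_strategy \<Rightarrow> bool" where
  "winning f g \<alpha> \<nu> \<longleftrightarrow>
     (\<forall>m. \<forall>F\<in>f m.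
        (\<forall>qs vs. reachable g \<alpha> \<nu> m F qs vs \<longrightarrow> no_immediate_loss g \<alpha> \<nu> m F qs vs)
        \<and> (\<nexists>q v. infinite_play g \<alpha> \<nu> m F q v))"

definition reducible :: "T3_oracle \<Rightarrow> T3_oracle \<Rightarrow> bool" where
  "reducible f g \<longleftrightarrow> (\<exists>\<alpha> \<nu>. computable_strategy \<alpha> \<and> winning f g \<alpha> \<nu>)"


section \<open>Degrees\<close>

text \<open>A T3 degree is an equivalence class of T3 oracles under mutual reducibility.\<close>

definition T3_degree :: "T3_oracle \<Rightarrow> T3_oracle set" where
  "T3_degree f = {g. reducible f g \<and> reducible g f}"

definition degree_le :: "T3_oracle set \<Rightarrow> T3_oracle set \<Rightarrow> bool" (infix \<open>\<preceq>\<close> 50) where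
  "a \<preceq> b \<longleftrightarrow> (\<exists>f\<in>a. \<exists>g\<in>b. reducible f g)"

definition T3_degrees :: "T3_oracle set set" where
  "T3_degrees = range T3_degree"

definition T0_degrees :: "T3_oracle set set" where
  "T0_degrees = range (\<lambda>g. T3_degree (T0_to_T3 g))"

definition turing_degree :: "nat set \<Rightarrow> T3_oracle set" where
  "turing_degree A = T3_degree (T0_to_T3 (char_fun A))"

definition decoding_oracle :: "nat set \<Rightarrow> nat set \<Rightarrow> T1_oracle" where
  "decoding_oracle P Q n = (if n \<in> P then Some 0 else if n \<in> Q then Some 1 else None)"

definition decoding_degree :: "nat set \<Rightarrow> nat set \<Rightarrow> T3_oracle set" where
  "decoding_degree P Q = T3_degree (T1_to_T3 (decoding_oracle P Q))"

definition coding_degree :: "nat set \<Rightarrow> nat set \<Rightarrow> T3_oracle set" where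
  "coding_degree P Q = T3_degree (basic_to_T3 {P, Q})"

definition H :: "nat \<Rightarrow> nat set \<Rightarrow> nat set" where
  "H i A = {e. phi A e 0 = Some i}"

definition d_tilde :: "nat set \<Rightarrow> T3_oracle set" where
  "d_tilde A = decoding_degree (H 0 A) (H 1 A)"

definition c_tilde :: "nat set \<Rightarrow> T3_oracle set" where
  "c_tilde A = coding_degree (H 0 A) (H 1 A)"

text \<open>
  The rule sending the Turing degree of \<open>A\<close> to its co-Turing degree. The description is not known
  beforehand to be single-valued, nor to be defined on every T0 degree.
\<close>

definition coT :: "T3_oracle set \<Rightarrow> T3_oracle set" where
  "coT a = (THE c. \<exists>A. a = turing_degree A \<and> c = c_tilde A)"

end

theory Submission
  imports Defs
begin

text \<open>
  Each of the three comparisons of \<open>A\<close> and \<open>B\<close> is equivalent to: the characteristic function of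
  \<open>B\<close> is computable with oracle \<open>A\<close>.

  If \<open>B\<close> is computable from \<open>A\<close>, then replacing the oracle call in a program by a program that
  computes \<open>B\<close> from \<open>A\<close> is a computable map of program codes that sends \<open>H i B\<close> into \<open>H i A\<close> for
  \<open>i = 0, 1\<close>. So Arthur needs a single query, for the coding as well as for the decoding oracles.
  Conversely, against a decoding oracle, which leaves Nimue and Merlin no choice, an oracle for \<open>A\<close>
  suffices to play the whole game, and asking for the value of the program \<open>ask n\<close>, which outputs
  \<open>B(n)\<close>, yields \<open>B\<close> (\<open>computable_if_reducible_T1\<close>).

  The main point is that a reduction of the coding oracle of \<open>A\<close> to that of \<open>B\<close> computes \<open>B\<close> from
  \<open>A\<close>. Besides \<open>ask n\<close>, let \<open>ask_not n\<close> be a program that outputs \<open>1 - B(n)\<close>. Whichever of the two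
  sets Nimue chooses, exactly one of the two programs belongs to it. Call a position \<^emph>\<open>forced\<close> into
  \<open>U\<close> if Arthur declares an element of \<open>U\<close> there, or if he makes a query and there is an \<open>n\<close> such that
  both answers \<open>ask n\<close> and \<open>ask_not n\<close> lead to positions forced into \<open>U\<close>. From a forced position
  Merlin can drive Arthur into \<open>U\<close> against any Nimue (\<open>forced_meets_target\<close>). On the other hand, if
  \<open>B\<close> is not computable from \<open>A\<close>, then every position won with target \<open>H i A\<close> is forced into \<open>H i A\<close>
  (\<open>forced_if_won\<close>): by induction, after a query all answers in the set \<open>H j B\<close> chosen by Nimue lead
  to forced positions; if there were no \<open>n\<close> for which both answers do, then the forced one of the two
  would tell \<open>B(n)\<close>, for all \<open>n\<close>, and being forced is semidecidable with oracle \<open>A\<close>. But the initial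
  position is won for both targets \<open>H 0 A\<close> and \<open>H 1 A\<close>, so Merlin could drive Arthur into \<open>H 0 A\<close>
  when the target is \<open>H 1 A\<close>, although these sets are disjoint.

  The rest is infrastructure. All computability claims are reduced to one principle
  (\<open>semidecidable_derivable\<close>): a set defined inductively by semidecidable rules is semidecidable.
  It gives universal evaluation of programs, recursion on lists, the simulation of games and the
  composition of strategies. Nimue's strategies are eliminated by describing the positions that
  Arthur's strategy can win as a least fixed point (\<open>reducible_iff_won\<close>), which turns arguments about
  infinite plays into inductions.
\<close>

section \<open>Computable functions and semidecidable sets\<close>

abbreviation pair :: "nat \<Rightarrow> nat \<Rightarrow> nat" (\<open>\<langle>_,/ _\<rangle>\<close>) where
  "\<langle>a, b\<rangle> \<equiv> prod_encode (a, b)"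

abbreviation pfst :: "nat \<Rightarrow> nat" where "pfst x \<equiv> fst (prod_decode x)"
abbreviation psnd :: "nat \<Rightarrow> nat" where "psnd x \<equiv> snd (prod_decode x)"

definition computable_in :: "(nat \<Rightarrow> nat) \<Rightarrow> (nat \<Rightarrow> nat) \<Rightarrow> bool" where
  "computable_in g f \<longleftrightarrow> (\<exists>p. \<forall>x. run g p x = Some (f x))"

lemma computable_compose:
  assumes "computable_in g f" "computable_in g h"
  shows "computable_in g (\<lambda>x. f (h x))"
proof -
  from assms obtain p q where "\<forall>x. run g p x = Some (f x)" "\<forall>x. run g q x = Some (h x)"
    unfolding computable_in_def by blast
  then have "\<forall>x. run g (PComp p q) x = Some (f (h x))" by simp
  then show ?thesis unfolding computable_in_def by blast
qed

lemma computable_oracle: "computable_in g g"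
  unfolding computable_in_def by (rule exI[of _ POracle]) simp

lemma computable_Suc: "computable_in g f \<Longrightarrow> computable_in g (\<lambda>x. Suc (f x))"
  by (rule computable_compose) (auto simp: computable_in_def intro: exI[of _ PSucc])

lemma computable_fst: "computable_in g f \<Longrightarrow> computable_in g (\<lambda>x. pfst (f x))"
  by (rule computable_compose[where f = pfst]) (auto simp: computable_in_def intro: exI[of _ PFst])

lemma computable_snd: "computable_in g f \<Longrightarrow> computable_in g (\<lambda>x. psnd (f x))"
  by (rule computable_compose[where f = psnd]) (auto simp: computable_in_def intro: exI[of _ PSnd])

lemma computable_pair:
  assumes "computable_in g f" "computable_in g h"
  shows "computable_in g (\<lambda>x. \<langle>f x, h x\<rangle>)"
proof -
  from assms obtain p q where "\<forall>x. run g p x = Some (f x)" "\<forall>x. run g q x = Some (h x)"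
    unfolding computable_in_def by blast
  then have "\<forall>x. run g (PPair p q) x = Some \<langle>f x, h x\<rangle>" by simp
  then show ?thesis unfolding computable_in_def by blast
qed

lemma computable_id: "computable_in g (\<lambda>x. x)"
proof -
  have "run g (PPair PFst PSnd) x = Some x" for x by simp
  then show ?thesis unfolding computable_in_def by blast
qed

lemma computable_const: "computable_in g (\<lambda>x. c)"
proof (induction c)
  case 0
  show ?case unfolding computable_in_def by (rule exI[of _ PZero]) simp
next
  case (Suc c)
  then show ?case by (rule computable_Suc)
qed

lemma computable_rec:
  assumes "computable_in g a" "computable_in g n"
    and "computable_in g (\<lambda>z. q (pfst z) (pfst (psnd z)) (psnd (psnd z)))"
  shows "computable_in g (\<lambda>x. rec_nat (a x) (q x) (n x))"
proof -
  from assms obtain pa pq where pa: "\<And>x. run g pa x = Some (a x)"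
    and pq: "\<And>z. run g pq z = Some (q (pfst z) (pfst (psnd z)) (psnd (psnd z)))"
    unfolding computable_in_def by blast
  have "rec_nat (run g pa x) (\<lambda>k r. Option.bind r (\<lambda>y. run g pq \<langle>x, \<langle>k, y\<rangle>\<rangle>)) k
      = Some (rec_nat (a x) (q x) k)" for x k
    by (induction k) (simp_all add: pa pq)
  then have "run g (PRec pa pq) z = Some (rec_nat (a (pfst z)) (q (pfst z)) (psnd z))" for z
    by simp
  then have "computable_in g (\<lambda>z. rec_nat (a (pfst z)) (q (pfst z)) (psnd z))"
    unfolding computable_in_def by blast
  from computable_compose[OF this computable_pair[OF computable_id assms(2)]]
  show ?thesis by simp
qed

lemma computable_add:
  assumes "computable_in g a" "computable_in g b"
  shows "computable_in g (\<lambda>x. a x + b x)"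
proof -
  have "rec_nat m (\<lambda>_ r. Suc r) n = m + n" for m n by (induction n) simp_all
  moreover have "computable_in g (\<lambda>x. rec_nat (a x) (\<lambda>_ r. Suc r) (b x))"
    by (intro computable_rec assms computable_Suc computable_snd computable_id)
  ultimately show ?thesis by simp
qed

lemma computable_mult:
  assumes "computable_in g a" "computable_in g b"
  shows "computable_in g (\<lambda>x. a x * b x)"
proof -
  have "rec_nat 0 (\<lambda>_ r. r + m) n = m * n" for m n :: nat by (induction n) simp_all
  moreover have "computable_in g (\<lambda>x. rec_nat 0 (\<lambda>_ r. r + a x) (b x))"
    by (intro computable_rec assms computable_add computable_snd computable_id computable_fst
        computable_const computable_compose[where f = a])
  ultimately show ?thesis by simp
qed

lemma computable_diff:
  assumes "computable_in g a" "computable_in g b"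
  shows "computable_in g (\<lambda>x. a x - b x)"
proof -
  have pred: "rec_nat 0 (\<lambda>k _. k) n = n - 1" for n by (cases n) simp_all
  have "computable_in g (\<lambda>x. rec_nat 0 (\<lambda>k _. k) x)"
    by (intro computable_rec computable_const computable_id computable_fst computable_snd)
  then have c: "computable_in g (\<lambda>x. x - 1)" unfolding pred .
  have "rec_nat m (\<lambda>_ r. r - 1) n = m - n" for m n :: nat by (induction n) simp_all
  moreover have "computable_in g (\<lambda>x. rec_nat (a x) (\<lambda>_ r. r - 1) (b x))"
    by (intro computable_rec assms computable_snd computable_id computable_compose[OF c])
  ultimately show ?thesis by simp
qed

lemma computable_if_zero:
  assumes "computable_in g c" "computable_in g a" "computable_in g b"
  shows "computable_in g (\<lambda>x. if c x = 0 then a x else b x)"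
proof -
  have "rec_nat m (\<lambda>_ _. n) k = (if k = 0 then m else n)" for m n k :: nat by (cases k) simp_all
  moreover have "computable_in g (\<lambda>x. rec_nat (a x) (\<lambda>_ _. b x) (c x))"
    by (intro computable_rec assms computable_compose[where f = b] computable_fst computable_id)
  ultimately show ?thesis by simp
qed

lemmas computable_intros =
  computable_const computable_id computable_Suc computable_fst computable_snd computable_pair
  computable_add computable_mult computable_diff

text \<open>
  Being the projection of a decidable relation, rather than the domain of a program, makes closure
  under conjunction, disjunction and existential quantification immediate.
\<close>

definition semidecidable_in :: "(nat \<Rightarrow> nat) \<Rightarrow> (nat \<Rightarrow> bool) \<Rightarrow> bool" where
  "semidecidable_in g S \<longleftrightarrow> (\<exists>f. computable_in g f \<and> (\<forall>x. S x \<longleftrightarrow> (\<exists>c. f \<langle>x, c\<rangle> = 0)))"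

lemma semidecidable_cong:
  "semidecidable_in g S \<Longrightarrow> (\<And>x. S x \<longleftrightarrow> T x) \<Longrightarrow> semidecidable_in g T"
  unfolding semidecidable_in_def by simp

lemma semidecidable_eq:
  assumes "computable_in g a" "computable_in g b"
  shows "semidecidable_in g (\<lambda>x. a x = b x)"
proof -
  have "computable_in g (\<lambda>z. (a (pfst z) - b (pfst z)) + (b (pfst z) - a (pfst z)))"
    by (intro computable_intros computable_compose[OF assms(1)] computable_compose[OF assms(2)])
  then show ?thesis unfolding semidecidable_in_def
    by (intro exI conjI) (assumption, auto)
qed

lemma semidecidable_const: "semidecidable_in g (\<lambda>x. P)"
proof (cases P)
  case True
  then show ?thesis using semidecidable_eq[OF computable_id computable_id] by simp
next
  case False
  have "semidecidable_in g (\<lambda>x. (0::nat) = 1)" by (intro semidecidable_eq computable_const)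
  then show ?thesis using False by simp
qed

lemma semidecidable_conj:
  assumes "semidecidable_in g P" "semidecidable_in g Q"
  shows "semidecidable_in g (\<lambda>x. P x \<and> Q x)"
proof -
  from assms obtain p q where pq: "computable_in g p" "computable_in g q"
    "\<And>x. P x \<longleftrightarrow> (\<exists>c. p \<langle>x, c\<rangle> = 0)" "\<And>x. Q x \<longleftrightarrow> (\<exists>c. q \<langle>x, c\<rangle> = 0)"
    unfolding semidecidable_in_def by blast
  let ?f = "\<lambda>z. p \<langle>pfst z, pfst (psnd z)\<rangle> + q \<langle>pfst z, psnd (psnd z)\<rangle>"
  have "computable_in g ?f"
    by (intro computable_intros computable_compose[OF pq(1)] computable_compose[OF pq(2)])
  moreover have "P x \<and> Q x \<longleftrightarrow> (\<exists>c. ?f \<langle>x, c\<rangle> = 0)" for x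
  proof
    assume "P x \<and> Q x"
    then obtain c d where "p \<langle>x, c\<rangle> = 0" "q \<langle>x, d\<rangle> = 0" using pq by blast
    then have "?f \<langle>x, \<langle>c, d\<rangle>\<rangle> = 0" by simp
    then show "\<exists>c. ?f \<langle>x, c\<rangle> = 0" ..
  qed (auto simp: pq)
  ultimately show ?thesis unfolding semidecidable_in_def by blast
qed

lemma semidecidable_disj:
  assumes "semidecidable_in g P" "semidecidable_in g Q"
  shows "semidecidable_in g (\<lambda>x. P x \<or> Q x)"
proof -
  from assms obtain p q where pq: "computable_in g p" "computable_in g q"
    "\<And>x. P x \<longleftrightarrow> (\<exists>c. p \<langle>x, c\<rangle> = 0)" "\<And>x. Q x \<longleftrightarrow> (\<exists>c. q \<langle>x, c\<rangle> = 0)"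
    unfolding semidecidable_in_def by blast
  have "computable_in g (\<lambda>z. p z * q z)" by (intro computable_intros pq)
  then show ?thesis unfolding semidecidable_in_def
    by (intro exI conjI) (assumption, auto simp: pq)
qed

lemma semidecidable_compose:
  assumes "semidecidable_in g S" "computable_in g h"
  shows "semidecidable_in g (\<lambda>x. S (h x))"
proof -
  from assms obtain f where f: "computable_in g f" "\<And>x. S x \<longleftrightarrow> (\<exists>c. f \<langle>x, c\<rangle> = 0)"
    unfolding semidecidable_in_def by blast
  have "computable_in g (\<lambda>z. f \<langle>h (pfst z), psnd z\<rangle>)"
    by (intro computable_compose[OF f(1)] computable_intros computable_compose[OF assms(2)])
  then show ?thesis unfolding semidecidable_in_def
    by (intro exI conjI) (assumption, auto simp: f)
qed

lemma semidecidable_ex: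
  assumes "semidecidable_in g (\<lambda>z. P (pfst z) (psnd z))"
  shows "semidecidable_in g (\<lambda>x. \<exists>y. P x y)"
proof -
  from assms obtain f where f: "computable_in g f"
      "\<And>z. P (pfst z) (psnd z) \<longleftrightarrow> (\<exists>c. f \<langle>z, c\<rangle> = 0)"
    unfolding semidecidable_in_def by blast
  let ?f = "\<lambda>z. f \<langle>\<langle>pfst z, pfst (psnd z)\<rangle>, psnd (psnd z)\<rangle>"
  have "computable_in g ?f" by (intro computable_compose[OF f(1)] computable_intros)
  moreover have "(\<exists>y. P x y) \<longleftrightarrow> (\<exists>c. ?f \<langle>x, c\<rangle> = 0)" for x
  proof
    assume "\<exists>y. P x y"
    then obtain y where "P x y" ..
    then obtain c where "f \<langle>\<langle>x, y\<rangle>, c\<rangle> = 0" using f(2)[of "\<langle>x, y\<rangle>"] by auto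
    then have "?f \<langle>x, \<langle>y, c\<rangle>\<rangle> = 0" by simp
    then show "\<exists>c. ?f \<langle>x, c\<rangle> = 0" ..
  next
    assume "\<exists>c. ?f \<langle>x, c\<rangle> = 0"
    then show "\<exists>y. P x y" using f(2) by (metis fst_conv prod_encode_inverse snd_conv)
  qed
  ultimately show ?thesis unfolding semidecidable_in_def by blast
qed

lemmas semidecidable_intros =
  semidecidable_const semidecidable_eq semidecidable_conj semidecidable_disj semidecidable_ex

lemma semidecidable_compose2:
  assumes "semidecidable_in g (\<lambda>z. R (pfst z) (psnd z))" "computable_in g a" "computable_in g b"
  shows "semidecidable_in g (\<lambda>x. R (a x) (b x))"
  using semidecidable_compose[OF assms(1) computable_pair[OF assms(2,3)]] by simp

text \<open>
  Search through all pairs of a value and a witness for it, and return the value of the first hit.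
\<close>

lemma semidecidable_uniformization:
  assumes "semidecidable_in g (\<lambda>z. R (pfst z) (psnd z))"
  obtains p where "\<And>x y. run g p x = Some y \<Longrightarrow> R x y" "\<And>x y. R x y \<Longrightarrow> run g p x \<noteq> None"
proof -
  from assms obtain f where f: "computable_in g f"
      "\<And>z. R (pfst z) (psnd z) \<longleftrightarrow> (\<exists>c. f \<langle>z, c\<rangle> = 0)"
    unfolding semidecidable_in_def by blast
  have "computable_in g (\<lambda>z. f \<langle>\<langle>pfst z, pfst (psnd z)\<rangle>, psnd (psnd z)\<rangle>)"
    by (intro computable_compose[OF f(1)] computable_intros)
  then obtain q where q: "\<And>z. run g q z = Some (f \<langle>\<langle>pfst z, pfst (psnd z)\<rangle>, psnd (psnd z)\<rangle>)"
    unfolding computable_in_def by blast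
  let ?p = "PComp PFst (PMu q)"
  have "R x y" if "run g ?p x = Some y" for x y
  proof -
    from that obtain n where n: "run g (PMu q) x = Some n" "y = pfst n"
      by (auto simp: Option.bind_eq_Some_conv simp del: run.simps(9))
    then have ex: "\<exists>n. run g q \<langle>x, n\<rangle> = Some 0" and "n = (LEAST n. run g q \<langle>x, n\<rangle> = Some 0)"
      by (auto split: if_splits)
    with LeastI_ex[OF ex] have "run g q \<langle>x, n\<rangle> = Some 0" by simp
    then have "f \<langle>\<langle>x, y\<rangle>, psnd n\<rangle> = 0" using q n(2) by simp
    then show ?thesis using f(2)[of "\<langle>x, y\<rangle>"] by auto
  qed
  moreover have "run g ?p x \<noteq> None" if "R x y" for x y
  proof -
    from that obtain c where "f \<langle>\<langle>x, y\<rangle>, c\<rangle> = 0" using f(2)[of "\<langle>x, y\<rangle>"] by auto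
    then have "run g q \<langle>x, \<langle>y, c\<rangle>\<rangle> = Some 0" using q by simp
    then have "\<exists>n. run g q \<langle>x, n\<rangle> = Some 0 \<and> (\<forall>k<n. run g q \<langle>x, k\<rangle> \<noteq> None)"
      using q by (intro exI[of _ "\<langle>y, c\<rangle>"]) simp
    then show ?thesis by simp
  qed
  ultimately show thesis by (rule that)
qed

lemma computable_if_semidecidable_graph:
  assumes "semidecidable_in g (\<lambda>z. f (pfst z) = psnd z)"
  shows "computable_in g f"
proof -
  obtain p where "\<And>x y. run g p x = Some y \<Longrightarrow> f x = y" "\<And>x y. f x = y \<Longrightarrow> run g p x \<noteq> None"
    using semidecidable_uniformization[where R = "\<lambda>x y. f x = y", OF assms] by blast
  then have "\<forall>x. run g p x = Some (f x)" by (metis option.exhaust)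
  then show ?thesis unfolding computable_in_def by blast
qed

section \<open>Inductive definitions are semidecidable\<close>

text \<open>
  Rules with two premises suffice: a rule with one premise repeats it, and longer lists of premises
  are built up by auxiliary judgements.
\<close>

inductive derivable :: "(nat \<Rightarrow> bool) \<Rightarrow> (nat \<Rightarrow> nat \<Rightarrow> nat \<Rightarrow> bool) \<Rightarrow> nat \<Rightarrow> bool"
  for Ax :: "nat \<Rightarrow> bool" and Rl :: "nat \<Rightarrow> nat \<Rightarrow> nat \<Rightarrow> bool" where
  axiom: "Ax x \<Longrightarrow> derivable Ax Rl x"
| rule: "Rl x y z \<Longrightarrow> derivable Ax Rl y \<Longrightarrow> derivable Ax Rl z \<Longrightarrow> derivable Ax Rl x"

text \<open>
  Derivable numbers are enumerated in stages. Stage \<open>s\<close> reads \<open>s\<close> as a proposed inference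
  \<open>((x, (y, z)), (w, (t, u)))\<close>: the number \<open>x\<close> is to be enumerated, either as an axiom or from the
  premises \<open>y\<close> and \<open>z\<close>, the witness \<open>w\<close> attests the axiom or the rule, and the premises have been
  enumerated at the stages \<open>t\<close> and \<open>u\<close>. As pairing is monotone, \<open>t\<close> and \<open>u\<close> are at most \<open>s\<close>. So
  a derivable \<open>x\<close> turns up at the stage that codes its last inference.
\<close>

theorem semidecidable_derivable:
  assumes "semidecidable_in g Ax"
    and "semidecidable_in g (\<lambda>t. Rl (pfst t) (pfst (psnd t)) (psnd (psnd t)))"
  shows "semidecidable_in g (derivable Ax Rl)"
proof -
  obtain a where a: "computable_in g a" "\<And>x. Ax x \<longleftrightarrow> (\<exists>c. a \<langle>x, c\<rangle> = 0)"
    using assms(1) unfolding semidecidable_in_def by blast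
  obtain r where r: "computable_in g r"
      "\<And>t. Rl (pfst t) (pfst (psnd t)) (psnd (psnd t)) \<longleftrightarrow> (\<exists>c. r \<langle>t, c\<rangle> = 0)"
    using assms(2) unfolding semidecidable_in_def by blast
  \<comment> \<open>The history \<open>E\<close> at stage \<open>s\<close> is a nested pair with the latest entry outermost; the entry \<open>Suc x\<close>
    records that \<open>x\<close> is enumerated, and \<open>0\<close> that nothing is. The history at stage \<open>t\<close> is reached
    from it by taking \<open>s - t\<close> second components.\<close>
  define before where "before E s t = pfst (rec_nat E (\<lambda>_ r. psnd r) (s - t))" for E s t
  define fail where "fail s E =
    (let x = pfst (pfst s); yz = psnd (pfst s); w = pfst (psnd s);
         y = before E s (pfst (psnd (psnd s))); z = before E s (psnd (psnd (psnd s)))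
     in a \<langle>x, w\<rangle> * (r \<langle>\<langle>x, yz\<rangle>, w\<rangle> + ((y - Suc (pfst yz)) + (Suc (pfst yz) - y))
          + ((z - Suc (psnd yz)) + (Suc (psnd yz) - z))))" for s E
  define E where "E = rec_nat 0 (\<lambda>s E. \<langle>if fail s E = 0 then Suc (pfst (pfst s)) else 0, E\<rangle>)"
  have tail: "rec_nat (E s) (\<lambda>_ r. psnd r) i = E (s - i)" for s i
  proof (induction i)
    case (Suc i)
    have "psnd 0 = 0" by (metis le_prod_encode_2 le_zero_eq prod.collapse prod_decode_inverse)
    then have "psnd (E t) = E (t - 1)" for t by (cases t) (simp_all add: E_def)
    then show ?case using Suc by simp
  qed simp
  have before: "before (E s) s t = pfst (E (min s t))" for s t
    unfolding before_def tail by (simp add: min_def)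
  have fst0: "pfst 0 = 0" by (metis le_prod_encode_1 le_zero_eq prod.collapse prod_decode_inverse)
  have fst_E: "pfst (E (Suc s)) = (if fail s (E s) = 0 then Suc (pfst (pfst s)) else 0)" for s
    by (simp add: E_def)
  have sound: "derivable Ax Rl x" if "pfst (E s) = Suc x" for s x
    using that
  proof (induction s arbitrary: x rule: less_induct)
    case (less s)
    show ?case
    proof (cases s)
      case 0
      then show ?thesis using less.prems fst0 by (simp add: E_def)
    next
      case (Suc t)
      define yz where "yz = psnd (pfst t)"
      let ?i = "min t (pfst (psnd (psnd t)))" and ?j = "min t (psnd (psnd (psnd t)))"
      from less.prems Suc have f: "fail t (E t) = 0" and x: "x = pfst (pfst t)"
        by (auto simp: fst_E split: if_splits)
      from f consider "a \<langle>x, pfst (psnd t)\<rangle> = 0"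
        | "r \<langle>\<langle>x, yz\<rangle>, pfst (psnd t)\<rangle> = 0" "pfst (E ?i) = Suc (pfst yz)" "pfst (E ?j) = Suc (psnd yz)"
        unfolding fail_def Let_def before x yz_def by force
      then show ?thesis
      proof cases
        case 1
        then show ?thesis using a(2) by (blast intro: derivable.axiom)
      next
        case 2
        have "Rl x (pfst yz) (psnd yz)" using r(2)[of "\<langle>x, yz\<rangle>"] 2(1) by auto
        moreover have "derivable Ax Rl (pfst yz)" "derivable Ax Rl (psnd yz)"
          using less.IH[of ?i] less.IH[of ?j] 2 Suc by auto
        ultimately show ?thesis by (rule derivable.rule)
      qed
    qed
  qed
  have complete: "\<exists>s. pfst (E s) = Suc x" if "derivable Ax Rl x" for x
    using that
  proof induction
    case (axiom x)
    then obtain w where "a \<langle>x, w\<rangle> = 0" using a(2) by blast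
    then have "fail \<langle>\<langle>x, 0\<rangle>, \<langle>w, 0\<rangle>\<rangle> E' = 0" for E' by (simp add: fail_def)
    then have "pfst (E (Suc \<langle>\<langle>x, 0\<rangle>, \<langle>w, 0\<rangle>\<rangle>)) = Suc x" by (simp add: fst_E)
    then show ?case ..
  next
    case (rule x y z)
    then obtain s t where st: "pfst (E s) = Suc y" "pfst (E t) = Suc z" by blast
    obtain w where w: "r \<langle>\<langle>x, \<langle>y, z\<rangle>\<rangle>, w\<rangle> = 0" using rule(1) r(2)[of "\<langle>x, \<langle>y, z\<rangle>\<rangle>"] by auto
    define u where "u = \<langle>\<langle>x, \<langle>y, z\<rangle>\<rangle>, \<langle>w, \<langle>s, t\<rangle>\<rangle>\<rangle>"
    have "s \<le> u" "t \<le> u" unfolding u_def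
      by (meson le_prod_encode_1 le_prod_encode_2 order_trans)+
    then have "before (E u) u s = Suc y" "before (E u) u t = Suc z"
      using st by (simp_all add: before min_absorb2)
    moreover have "psnd (pfst u) = \<langle>y, z\<rangle>" "pfst (pfst u) = x" "pfst (psnd u) = w"
      "pfst (psnd (psnd u)) = s" "psnd (psnd (psnd u)) = t" by (simp_all add: u_def)
    ultimately have "fail u (E u) = 0" using w by (simp add: fail_def)
    then have "pfst (E (Suc u)) = Suc x" by (simp add: fst_E u_def)
    then show ?case ..
  qed
  have cb: "computable_in g (\<lambda>x. before (e x) (s x) (t x))"
    if "computable_in g e" "computable_in g s" "computable_in g t" for e s t
    unfolding before_def by (intro computable_intros computable_rec that)
  have cf: "computable_in g (\<lambda>x. fail (s x) (e x))"
    if "computable_in g e" "computable_in g s" for e s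
    unfolding fail_def Let_def
    by (intro computable_intros cb that computable_compose[OF a(1)] computable_compose[OF r(1)])
  have cE: "computable_in g E" unfolding E_def
    by (intro computable_rec computable_intros computable_if_zero cf)
  then have "semidecidable_in g (\<lambda>x. \<exists>s. pfst (E s) = Suc x)"
    by (intro semidecidable_intros computable_intros computable_compose[OF cE])
  moreover have "(\<exists>s. pfst (E s) = Suc x) \<longleftrightarrow> derivable Ax Rl x" for x
    using sound complete by blast
  ultimately show ?thesis by simp
qed

section \<open>Changing the oracle of a program\<close>

primrec replace_oracle :: "prog \<Rightarrow> prog \<Rightarrow> prog" where
  "replace_oracle q PZero = PZero"
| "replace_oracle q PSucc = PSucc"
| "replace_oracle q PFst = PFst"
| "replace_oracle q PSnd = PSnd"
| "replace_oracle q POracle = q"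
| "replace_oracle q (PPair a b) = PPair (replace_oracle q a) (replace_oracle q b)"
| "replace_oracle q (PComp a b) = PComp (replace_oracle q a) (replace_oracle q b)"
| "replace_oracle q (PRec a b) = PRec (replace_oracle q a) (replace_oracle q b)"
| "replace_oracle q (PMu a) = PMu (replace_oracle q a)"

lemma run_replace_oracle:
  assumes "\<And>x. run g q x = Some (h x)"
  shows "run g (replace_oracle q p) = run h p"
  by (induction p) (simp_all add: assms cong: if_cong)

abbreviation prog_decode :: "nat \<Rightarrow> prog" where "prog_decode \<equiv> inv prog_encode"

lemma prog_decode_encode [simp]: "prog_decode (prog_encode p) = p"
  by (simp add: inj_prog_encode)

lemma prog_encode_decode [simp]: "prog_encode (prog_decode e) = e"
  by (simp add: surj_prog_encode surj_f_inv_f)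

lemma prog_decode_simps [simp]:
  "prog_decode 0 = PZero" "prog_decode (Suc 0) = PSucc" "prog_decode 2 = PFst" "prog_decode 3 = PSnd"
  "prog_decode 4 = POracle"
  "prog_decode (5 + 4 * \<langle>a, b\<rangle>) = PPair (prog_decode a) (prog_decode b)"
  "prog_decode (6 + 4 * \<langle>a, b\<rangle>) = PComp (prog_decode a) (prog_decode b)"
  "prog_decode (7 + 4 * \<langle>a, b\<rangle>) = PRec (prog_decode a) (prog_decode b)"
  "prog_decode (8 + 4 * e) = PMu (prog_decode e)"
  by (rule inv_f_eq[OF inj_prog_encode], simp)+

text \<open>
  The graph of the translation is inductively defined along the structure of programs. The rule for
  minimization looks only at its first premise.
\<close>

lemma computable_replace_oracle:
  "computable_in g (\<lambda>e. prog_encode (replace_oracle q (prog_decode e)))"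
proof (rule computable_if_semidecidable_graph)
  define Ax where "Ax t \<longleftrightarrow> t = \<langle>0, 0\<rangle> \<or> t = \<langle>1, 1\<rangle> \<or> t = \<langle>2, 2\<rangle> \<or> t = \<langle>3, 3\<rangle> \<or> t = \<langle>4, prog_encode q\<rangle>" for t
  define Rl where "Rl t y z \<longleftrightarrow> (\<exists>a a' b b'. y = \<langle>a, a'\<rangle> \<and> z = \<langle>b, b'\<rangle> \<and>
      (t = \<langle>5 + 4 * \<langle>a, b\<rangle>, 5 + 4 * \<langle>a', b'\<rangle>\<rangle> \<or> t = \<langle>6 + 4 * \<langle>a, b\<rangle>, 6 + 4 * \<langle>a', b'\<rangle>\<rangle>
      \<or> t = \<langle>7 + 4 * \<langle>a, b\<rangle>, 7 + 4 * \<langle>a', b'\<rangle>\<rangle> \<or> t = \<langle>8 + 4 * a, 8 + 4 * a'\<rangle>))" for t y z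
  have "derivable Ax Rl \<langle>prog_encode p, prog_encode (replace_oracle q p)\<rangle>" for p
  proof (induction p)
    case (PPair a b)
    then show ?case by (rule derivable.rule[rotated]) (auto simp: Rl_def)
  next
    case (PComp a b)
    then show ?case by (rule derivable.rule[rotated]) (auto simp: Rl_def)
  next
    case (PRec a b)
    then show ?case by (rule derivable.rule[rotated]) (auto simp: Rl_def)
  next
    case (PMu a)
    from PMu PMu show ?case by (rule derivable.rule[rotated]) (auto simp: Rl_def)
  qed (rule derivable.axiom, simp add: Ax_def)+
  then have complete: "derivable Ax Rl \<langle>e, prog_encode (replace_oracle q (prog_decode e))\<rangle>" for e
    by (metis prog_encode_decode)
  have sound: "prog_encode (replace_oracle q (prog_decode (pfst t))) = psnd t" if "derivable Ax Rl t" for t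
    using that by induction (auto simp: Ax_def Rl_def)
  have "semidecidable_in g (derivable Ax Rl)" unfolding Ax_def Rl_def
    by (intro semidecidable_derivable semidecidable_intros computable_intros)
  moreover have "derivable Ax Rl t \<longleftrightarrow> prog_encode (replace_oracle q (prog_decode (pfst t))) = psnd t" for t
    using sound[of t] complete[of "pfst t"] by auto
  ultimately show "semidecidable_in g (\<lambda>t. prog_encode (replace_oracle q (prog_decode (pfst t))) = psnd t)"
    by (rule semidecidable_cong)
qed

section \<open>Lists\<close>

text \<open>
  The only recursion on lists that is programmed; length and appending an element are instances of it.
\<close>

lemma computable_foldr:
  assumes "computable_in g a" "computable_in g l"
    and "computable_in g (\<lambda>z. h (pfst z) (pfst (psnd z)) (psnd (psnd z)))"
  shows "computable_in g (\<lambda>x. foldr (h x) (list_decode (l x)) (a x))"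
proof -
  define Ax where "Ax t \<longleftrightarrow> (\<exists>x. t = \<langle>x, \<langle>0, a x\<rangle>\<rangle>)" for t
  define Rl where "Rl t y z \<longleftrightarrow> (\<exists>x v l r. t = \<langle>x, \<langle>Suc \<langle>v, l\<rangle>, h x v r\<rangle>\<rangle> \<and> y = \<langle>x, \<langle>l, r\<rangle>\<rangle> \<and> z = y)" for t y z
  have "derivable Ax Rl \<langle>x, \<langle>list_encode vs, foldr (h x) vs (a x)\<rangle>\<rangle>" for x vs
  proof (induction vs)
    case Nil
    show ?case by (rule derivable.axiom) (auto simp: Ax_def)
  next
    case (Cons v vs)
    from Cons Cons show ?case by (rule derivable.rule[rotated]) (auto simp: Rl_def)
  qed
  from this[of _ "list_decode l" for l]
  have complete: "derivable Ax Rl \<langle>x, \<langle>l, foldr (h x) (list_decode l) (a x)\<rangle>\<rangle>" for x l by simp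
  have sound: "foldr (h (pfst t)) (list_decode (pfst (psnd t))) (a (pfst t)) = psnd (psnd t)"
    if "derivable Ax Rl t" for t
    using that by induction (auto simp: Ax_def Rl_def)
  have h: "computable_in g (\<lambda>x. h (i x) (j x) (k x))"
    if "computable_in g i" "computable_in g j" "computable_in g k" for i j k
    using computable_compose[OF assms(3) computable_pair[OF that(1) computable_pair[OF that(2,3)]]]
    by simp
  have "semidecidable_in g (derivable Ax Rl)" unfolding Ax_def Rl_def
    by (intro semidecidable_derivable semidecidable_intros computable_intros h computable_compose[OF assms(1)])
  moreover have "derivable Ax Rl t \<longleftrightarrow>
      foldr (h (pfst t)) (list_decode (pfst (psnd t))) (a (pfst t)) = psnd (psnd t)" for t
    using sound[of t] complete[of "pfst t" "pfst (psnd t)"] by auto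
  ultimately have "semidecidable_in g
      (\<lambda>t. foldr (h (pfst t)) (list_decode (pfst (psnd t))) (a (pfst t)) = psnd (psnd t))"
    by (rule semidecidable_cong)
  from semidecidable_compose[OF this, of "\<lambda>z. \<langle>pfst (pfst z), \<langle>psnd (pfst z), psnd z\<rangle>\<rangle>"]
  have "semidecidable_in g (\<lambda>z. foldr (h (pfst (pfst z))) (list_decode (psnd (pfst z))) (a (pfst (pfst z))) = psnd z)"
    by (simp add: computable_intros)
  then have "computable_in g (\<lambda>z. foldr (h (pfst z)) (list_decode (psnd z)) (a (pfst z)))"
    by (rule computable_if_semidecidable_graph)
  from computable_compose[OF this computable_pair[OF computable_id assms(2)]]
  show ?thesis by simp
qed

lemma computable_length: "computable_in g l \<Longrightarrow> computable_in g (\<lambda>x. length (list_decode (l x)))"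
proof -
  assume l: "computable_in g l"
  have "foldr (\<lambda>_ r. Suc r) vs 0 = length vs" for vs :: "nat list" by (induction vs) simp_all
  moreover have "computable_in g (\<lambda>x. foldr (\<lambda>_ r. Suc r) (list_decode (l x)) 0)"
    by (intro computable_foldr l computable_intros)
  ultimately show ?thesis by simp
qed

lemma computable_snoc:
  assumes "computable_in g l" "computable_in g a"
  shows "computable_in g (\<lambda>x. list_encode (list_decode (l x) @ [a x]))"
proof -
  have "foldr (\<lambda>v r. Suc \<langle>v, r\<rangle>) vs (Suc \<langle>b, 0\<rangle>) = list_encode (vs @ [b])" for vs b
    by (induction vs) simp_all
  moreover have "computable_in g (\<lambda>x. foldr (\<lambda>v r. Suc \<langle>v, r\<rangle>) (list_decode (l x)) (Suc \<langle>a x, 0\<rangle>))"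
    by (intro computable_foldr assms computable_intros)
  ultimately show ?thesis by simp
qed

lemma computable_drop:
  assumes "computable_in g l" "computable_in g n"
  shows "computable_in g (\<lambda>x. list_encode (drop (n x) (list_decode (l x))))"
proof -
  have psnd0: "psnd 0 = 0" by (metis le_prod_encode_2 le_zero_eq prod.collapse prod_decode_inverse)
  have tl: "psnd (list_encode vs - 1) = list_encode (tl vs)" for vs
    by (cases vs) (simp_all add: psnd0)
  have "rec_nat (list_encode vs) (\<lambda>_ r. psnd (r - 1)) k = list_encode (drop k vs)" for vs k
    by (induction k) (simp_all add: tl[unfolded One_nat_def] tl_drop drop_Suc)
  moreover have "computable_in g (\<lambda>x. rec_nat (l x) (\<lambda>_ r. psnd (r - 1)) (n x))"
    by (intro computable_rec assms computable_intros)
  ultimately show ?thesis by (metis (lifting) ext list_decode_inverse)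
qed

lemma list_encode_eq_Suc: "list_encode vs = Suc \<langle>v, r\<rangle> \<longleftrightarrow> vs = v # list_decode r"
  by (cases vs) auto

lemma semidecidable_nth:
  assumes "computable_in g l" "computable_in g n" "computable_in g v"
  shows "semidecidable_in g (\<lambda>x. n x < length (list_decode (l x)) \<and> list_decode (l x) ! n x = v x)"
proof -
  have "(k < length vs \<and> vs ! k = u) \<longleftrightarrow> (\<exists>r. list_encode (drop k vs) = Suc \<langle>u, r\<rangle>)" for k vs u
  proof
    assume "k < length vs \<and> vs ! k = u"
    then have "list_encode (drop k vs) = Suc \<langle>u, list_encode (drop (Suc k) vs)\<rangle>"
      by (metis Cons_nth_drop_Suc list_encode.simps(2))
    then show "\<exists>r. list_encode (drop k vs) = Suc \<langle>u, r\<rangle>" ..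
  next
    assume "\<exists>r. list_encode (drop k vs) = Suc \<langle>u, r\<rangle>"
    then obtain ws where "drop k vs = u # ws" by (auto simp: list_encode_eq_Suc)
    then show "k < length vs \<and> vs ! k = u"
      by (metis drop_all hd_drop_conv_nth leI list.distinct(1) list.sel(1))
  qed
  moreover have "semidecidable_in g (\<lambda>x. \<exists>r. list_encode (drop (n x) (list_decode (l x))) = Suc \<langle>v x, r\<rangle>)"
    by (intro semidecidable_intros computable_intros computable_drop
        computable_compose[OF assms(1)] computable_compose[OF assms(2)] computable_compose[OF assms(3)])
  ultimately show ?thesis by simp
qed

lemma computable_map_upt:
  assumes "computable_in g n" "computable_in g (\<lambda>z. h (pfst z) (psnd z))"
  shows "computable_in g (\<lambda>x. list_encode (map (h x) [0..<n x]))"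
proof -
  have "rec_nat 0 (\<lambda>k r. list_encode (list_decode r @ [h x k])) m = list_encode (map (h x) [0..<m])" for x m
    by (induction m) simp_all
  moreover have "computable_in g (\<lambda>x. rec_nat 0 (\<lambda>k r. list_encode (list_decode r @ [h x k])) (n x))"
  proof (intro computable_rec assms(1) computable_snoc computable_intros)
    show "computable_in g (\<lambda>z. h (pfst z) (pfst (psnd z)))"
      using computable_compose[OF assms(2), of "\<lambda>z. \<langle>pfst z, pfst (psnd z)\<rangle>"]
      by (simp add: computable_intros)
  qed
  ultimately show ?thesis by simp
qed

section \<open>A universal evaluation relation\<close>

text \<open>
  The first component \<open>c\<close> is a parameter of the oracle. It lets one semidecidable relation speak
  about all finite pieces of an oracle at once. The judgement \<open>search_j c e x n\<close> says that the
  program \<open>e\<close> has nonzero values at \<open>(x, k)\<close> for all \<open>k < n\<close>; it splits the unboundedly many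
  premises of minimization into rules with two premises.
\<close>

abbreviation eval_j :: "nat \<Rightarrow> nat \<Rightarrow> nat \<Rightarrow> nat \<Rightarrow> nat" where
  "eval_j c e x y \<equiv> \<langle>c, \<langle>0, \<langle>e, \<langle>x, y\<rangle>\<rangle>\<rangle>\<rangle>"
abbreviation search_j :: "nat \<Rightarrow> nat \<Rightarrow> nat \<Rightarrow> nat \<Rightarrow> nat" where
  "search_j c e x n \<equiv> \<langle>c, \<langle>1, \<langle>e, \<langle>x, n\<rangle>\<rangle>\<rangle>\<rangle>"

inductive eval_axiom :: "(nat \<Rightarrow> nat \<Rightarrow> nat \<Rightarrow> bool) \<Rightarrow> nat \<Rightarrow> bool" for Orc where
  "eval_axiom Orc (eval_j c 0 x 0)"
| "eval_axiom Orc (eval_j c 1 x (Suc x))"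
| "eval_axiom Orc (eval_j c 2 x (pfst x))"
| "eval_axiom Orc (eval_j c 3 x (psnd x))"
| "Orc c x y \<Longrightarrow> eval_axiom Orc (eval_j c 4 x y)"
| "eval_axiom Orc (search_j c e x 0)"

inductive eval_rule :: "nat \<Rightarrow> nat \<Rightarrow> nat \<Rightarrow> bool" where
  "eval_rule (eval_j c (5 + 4 * \<langle>a, b\<rangle>) x \<langle>y, z\<rangle>) (eval_j c a x y) (eval_j c b x z)"
| "eval_rule (eval_j c (6 + 4 * \<langle>a, b\<rangle>) x z) (eval_j c b x y) (eval_j c a y z)"
| "eval_rule (eval_j c (7 + 4 * \<langle>a, b\<rangle>) \<langle>x, 0\<rangle> y) (eval_j c a x y) (eval_j c a x y)"
| "eval_rule (eval_j c (7 + 4 * \<langle>a, b\<rangle>) \<langle>x, Suc k\<rangle> z)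
     (eval_j c (7 + 4 * \<langle>a, b\<rangle>) \<langle>x, k\<rangle> y) (eval_j c b \<langle>x, \<langle>k, y\<rangle>\<rangle> z)"
| "eval_rule (search_j c e x (Suc n)) (search_j c e x n) (eval_j c e \<langle>x, n\<rangle> (Suc z))"
| "eval_rule (eval_j c (8 + 4 * e) x n) (search_j c e x n) (eval_j c e \<langle>x, n\<rangle> 0)"

abbreviation evaluates :: "(nat \<Rightarrow> nat \<Rightarrow> nat \<Rightarrow> bool) \<Rightarrow> nat \<Rightarrow> bool" where
  "evaluates Orc \<equiv> derivable (eval_axiom Orc) eval_rule"

lemmas evaluates_axiom = derivable.axiom[where Ax = "eval_axiom Orc" and Rl = eval_rule for Orc]
lemmas evaluates_step = derivable.rule[where Ax = "eval_axiom Orc" and Rl = eval_rule for Orc]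

lemma semidecidable_evaluates:
  assumes "semidecidable_in g (\<lambda>t. Orc (pfst t) (pfst (psnd t)) (psnd (psnd t)))"
  shows "semidecidable_in g (evaluates Orc)"
proof (rule semidecidable_derivable)
  have Orc: "semidecidable_in g (\<lambda>x. Orc (i x) (j x) (k x))"
    if "computable_in g i" "computable_in g j" "computable_in g k" for i j k
    using semidecidable_compose[OF assms computable_pair[OF that(1) computable_pair[OF that(2,3)]]]
    by simp
  show "semidecidable_in g (eval_axiom Orc)"
    unfolding eval_axiom.simps[abs_def]
    by (intro semidecidable_intros computable_intros Orc)
  show "semidecidable_in g (\<lambda>t. eval_rule (pfst t) (pfst (psnd t)) (psnd (psnd t)))"
    unfolding eval_rule.simps
    by (intro semidecidable_intros computable_intros)
qed

definition judgement_holds :: "(nat \<Rightarrow> nat) \<Rightarrow> nat \<Rightarrow> bool" where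
  "judgement_holds g j \<longleftrightarrow>
     (let e = pfst (psnd (psnd j)); x = pfst (psnd (psnd (psnd j))); y = psnd (psnd (psnd (psnd j)))
      in if pfst (psnd j) = 0 then run g (prog_decode e) x = Some y
         else \<forall>k<y. \<exists>z. run g (prog_decode e) \<langle>x, k\<rangle> = Some (Suc z))"

lemma run_PMu_eq_Some:
  "run g (PMu p) x = Some n \<longleftrightarrow>
     run g p \<langle>x, n\<rangle> = Some 0 \<and> (\<forall>k<n. \<exists>z. run g p \<langle>x, k\<rangle> = Some (Suc z))"
proof
  assume "run g (PMu p) x = Some n"
  then obtain m where m: "run g p \<langle>x, m\<rangle> = Some 0" "\<forall>k<m. run g p \<langle>x, k\<rangle> \<noteq> None"
    and n: "n = (LEAST n. run g p \<langle>x, n\<rangle> = Some 0)" by (auto split: if_splits)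
  have "run g p \<langle>x, n\<rangle> = Some 0" unfolding n by (rule LeastI[of _ m]) (rule m)
  moreover have "\<exists>z. run g p \<langle>x, k\<rangle> = Some (Suc z)" if "k < n" for k
  proof -
    have "n \<le> m" unfolding n by (rule Least_le) (rule m)
    then obtain y where "run g p \<langle>x, k\<rangle> = Some y" using m(2) \<open>k < n\<close> by (metis less_le_trans not_None_eq)
    moreover have "run g p \<langle>x, k\<rangle> \<noteq> Some 0" using \<open>k < n\<close> unfolding n by (rule not_less_Least)
    ultimately show ?thesis by (cases y) auto
  qed
  ultimately show "run g p \<langle>x, n\<rangle> = Some 0 \<and> (\<forall>k<n. \<exists>z. run g p \<langle>x, k\<rangle> = Some (Suc z))" by blast
next
  assume h: "run g p \<langle>x, n\<rangle> = Some 0 \<and> (\<forall>k<n. \<exists>z. run g p \<langle>x, k\<rangle> = Some (Suc z))"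
  then have "(LEAST n. run g p \<langle>x, n\<rangle> = Some 0) = n"
    by (intro Least_equality) (auto simp: not_less[symmetric])
  with h show "run g (PMu p) x = Some n" by fastforce
qed

lemma evaluates_sound_aux:
  assumes "evaluates Orc j" "\<And>x y. Orc (pfst j) x y \<Longrightarrow> g x = y"
  shows "judgement_holds g j"
  using assms
proof induction
  case (axiom j)
  then show ?case by (cases rule: eval_axiom.cases) (simp_all add: judgement_holds_def)
next
  case (rule j y z)
  from rule(1) have "pfst y = pfst j" "pfst z = pfst j" by (cases; simp)+
  with rule have "judgement_holds g y" "judgement_holds g z" by auto
  with rule(1) show ?case
    by cases (auto simp: judgement_holds_def less_Suc_eq run_PMu_eq_Some simp del: run.simps(9))
qed

lemma evaluates_sound:
  assumes "evaluates Orc (eval_j c e x y)" "\<And>x y. Orc c x y \<Longrightarrow> g x = y"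
  shows "run g (prog_decode e) x = Some y"
  using evaluates_sound_aux[of Orc "eval_j c e x y" g] assms by (simp add: judgement_holds_def)

text \<open>
  The use principle: a converging computation asks only finitely many questions, so it is already
  derivable from every oracle parameter that answers the questions below some bound correctly.
\<close>

lemma evaluates_complete:
  assumes "run g p x = Some y"
  shows "\<forall>\<^sub>F k in sequentially. \<forall>c. (\<forall>n<k. Orc c n (g n)) \<longrightarrow> evaluates Orc (eval_j c (prog_encode p) x y)"
  using assms
proof (induction p arbitrary: x y)
  case (PPair p q)
  from PPair.prems obtain u v where uv: "run g p x = Some u" "run g q x = Some v" "y = \<langle>u, v\<rangle>"
    by (auto simp: Option.bind_eq_Some_conv)
  from PPair.IH(1)[OF uv(1)] PPair.IH(2)[OF uv(2)] show ?case
    by eventually_elim (auto simp: uv(3) intro: evaluates_step[OF eval_rule.intros(1)])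
next
  case (PComp p q)
  from PComp.prems obtain u where uv: "run g q x = Some u" "run g p u = Some y"
    by (auto simp: Option.bind_eq_Some_conv)
  from PComp.IH(2)[OF uv(1)] PComp.IH(1)[OF uv(2)] show ?case
    by eventually_elim (auto intro: evaluates_step[OF eval_rule.intros(2)])
next
  case (PRec p q)
  have "\<forall>\<^sub>F k in sequentially. \<forall>c. (\<forall>n<k. Orc c n (g n)) \<longrightarrow>
      evaluates Orc (eval_j c (prog_encode (PRec p q)) \<langle>a, m\<rangle> y)"
    if "run g (PRec p q) \<langle>a, m\<rangle> = Some y" for a m
    using that
  proof (induction m arbitrary: y)
    case 0
    then have "run g p a = Some y" by simp
    from PRec.IH(1)[OF this] show ?case
      by eventually_elim (auto intro: evaluates_step[OF eval_rule.intros(3)])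
  next
    case (Suc m)
    from Suc.prems obtain u where u: "run g (PRec p q) \<langle>a, m\<rangle> = Some u" "run g q \<langle>a, \<langle>m, u\<rangle>\<rangle> = Some y"
      by (auto simp: Option.bind_eq_Some_conv)
    from Suc.IH[OF u(1)] PRec.IH(2)[OF u(2)] show ?case
      by eventually_elim (auto intro: evaluates_step[OF eval_rule.intros(4)])
  qed
  from this[of "pfst x" "psnd x"] PRec.prems show ?case by simp
next
  case (PMu p)
  then have z: "run g p \<langle>x, y\<rangle> = Some 0" and s: "\<forall>k<y. \<exists>z. run g p \<langle>x, k\<rangle> = Some (Suc z)"
    unfolding run_PMu_eq_Some by auto
  from s have "\<forall>\<^sub>F k in sequentially. \<forall>c. (\<forall>n<k. Orc c n (g n)) \<longrightarrow>
      evaluates Orc (search_j c (prog_encode p) x y)"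
  proof (induction y)
    case 0
    show ?case using evaluates_axiom[OF eval_axiom.intros(6)] by (intro always_eventually) blast
  next
    case (Suc y)
    then obtain z where z: "run g p \<langle>x, y\<rangle> = Some (Suc z)" by blast
    have "\<forall>k<y. \<exists>z. run g p \<langle>x, k\<rangle> = Some (Suc z)" using Suc.prems by simp
    from Suc.IH[OF this] PMu.IH[OF z] show ?case
      by eventually_elim (auto intro: evaluates_step[OF eval_rule.intros(5)] simp del: One_nat_def)
  qed
  with PMu.IH[OF z] show ?case
    by eventually_elim (auto intro: evaluates_step[OF eval_rule.intros(6)] simp del: One_nat_def)
next
  case POracle
  then have y: "y = g x" by simp
  from eventually_gt_at_top[of x] show ?case
    by (rule eventually_mono) (auto simp: y intro!: evaluates_axiom eval_axiom.intros(5))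
qed (auto intro!: always_eventually intro: evaluates_axiom eval_axiom.intros simp del: One_nat_def)

theorem semidecidable_run:
  assumes "computable_in g h" "computable_in g e" "computable_in g x" "computable_in g y"
  shows "semidecidable_in g (\<lambda>t. run h (prog_decode (e t)) (x t) = Some (y t))"
proof -
  let ?Orc = "\<lambda>c n v. h n = v"
  have "semidecidable_in g (evaluates ?Orc)"
    by (intro semidecidable_evaluates semidecidable_intros computable_compose[OF assms(1)] computable_intros)
  then have "semidecidable_in g (\<lambda>t. evaluates ?Orc (eval_j 0 (e t) (x t) (y t)))"
    by (rule semidecidable_compose) (intro computable_intros assms)
  moreover have "evaluates ?Orc (eval_j 0 e x y) \<longleftrightarrow> run h (prog_decode e) x = Some y" for e x y
  proof
    show "run h (prog_decode e) x = Some y" if "evaluates ?Orc (eval_j 0 e x y)"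
      using evaluates_sound[OF that] by blast
    show "evaluates ?Orc (eval_j 0 e x y)" if "run h (prog_decode e) x = Some y"
      using eventually_happens[OF evaluates_complete[OF that, of ?Orc]] by simp
  qed
  ultimately show ?thesis by simp
qed

section \<open>Winning positions\<close>

text \<open>
  \<open>won g \<alpha> m F vs\<close>: after Merlin's moves \<open>vs\<close>, Arthur can win by following \<open>\<alpha>\<close>, with a suitable
  Nimue. As a least fixed point this excludes infinite plays.
\<close>

inductive won ::
  "T3_oracle \<Rightarrow> arthur_strategy \<Rightarrow> nat \<Rightarrow> nat set \<Rightarrow> nat list \<Rightarrow> bool"
  for g :: T3_oracle and \<alpha> :: arthur_strategy and m :: nat and F :: "nat set" where
  declares: "\<alpha> m vs = Some (Declare u) \<Longrightarrow> u \<in> F \<Longrightarrow> won g \<alpha> m F vs"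
| queries: "\<alpha> m vs = Some (Query n) \<Longrightarrow> G \<in> g n \<Longrightarrow> (\<And>v. v \<in> G \<Longrightarrow> won g \<alpha> m F (vs @ [v]))
    \<Longrightarrow> won g \<alpha> m F vs"

text \<open>
  A single strategy of Nimue that depends on Merlin's moves alone is to work at all positions. The
  sets \<open>G\<close> in the definition of \<open>won\<close> cannot be picked independently for each position, as an
  arbitrary \<open>G\<close> that leads to won positions may lie higher in the fixed point construction than the
  one that the derivation uses; so the strategy is extracted along the derivation.
\<close>

inductive won_by ::
  "T3_oracle \<Rightarrow> arthur_strategy \<Rightarrow> (nat list \<Rightarrow> nat set) \<Rightarrow> nat \<Rightarrow> nat set \<Rightarrow> nat list \<Rightarrow> bool"
  for g :: T3_oracle and \<alpha> :: arthur_strategy and \<nu> :: "nat list \<Rightarrow> nat set" and m :: nat and F :: "nat set" where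
  declares: "\<alpha> m vs = Some (Declare u) \<Longrightarrow> u \<in> F \<Longrightarrow> won_by g \<alpha> \<nu> m F vs"
| queries: "\<alpha> m vs = Some (Query n) \<Longrightarrow> \<nu> vs \<in> g n \<Longrightarrow> (\<And>v. v \<in> \<nu> vs \<Longrightarrow> won_by g \<alpha> \<nu> m F (vs @ [v]))
    \<Longrightarrow> won_by g \<alpha> \<nu> m F vs"

lemma won_by_cong:
  assumes "won_by g \<alpha> \<nu> m F vs" "\<And>ws. \<nu>' (vs @ ws) = \<nu> (vs @ ws)"
  shows "won_by g \<alpha> \<nu>' m F vs"
  using assms
proof induction
  case (declares vs u)
  then show ?case by (blast intro: won_by.declares)
next
  case (queries vs n)
  have "\<nu>' vs = \<nu> vs" using queries.prems[of "[]"] by simp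
  moreover have "won_by g \<alpha> \<nu>' m F (vs @ [v])" if "v \<in> \<nu> vs" for v
    using queries.IH[OF that] queries.prems[of "v # _"] by simp
  ultimately show ?case using queries.hyps(1,2) by (auto intro: won_by.queries)
qed

text \<open>
  The strategies obtained for the different answers of Merlin concern disjoint sets of later
  positions, so they can be glued together.
\<close>

lemma won_imp_won_by:
  assumes "won g \<alpha> m F vs"
  shows "\<exists>\<nu>. won_by g \<alpha> \<nu> m F vs"
  using assms
proof induction
  case (declares vs u)
  then show ?case by (blast intro: won_by.declares)
next
  case (queries vs n G)
  then obtain N where N: "\<And>v. v \<in> G \<Longrightarrow> won_by g \<alpha> (N v) m F (vs @ [v])" by metis
  define \<nu> where "\<nu> ws = (if ws = vs then G else N (ws ! length vs) ws)" for ws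
  have "won_by g \<alpha> \<nu> m F (vs @ [v])" if "v \<in> G" for v
    by (rule won_by_cong[OF N[OF that]]) (simp add: \<nu>_def nth_append)
  then have "won_by g \<alpha> \<nu> m F vs"
    using queries.hyps(2) by - (rule won_by.queries[of \<alpha> m, OF queries.hyps(1)], simp_all add: \<nu>_def)
  then show ?case by blast
qed

lemma no_infinite_play_if_won_by:
  assumes "won_by g \<alpha> (\<nu> m F []) m F vs" "\<And>qs vs. \<nu> m F qs vs = \<nu> m F [] vs"
    and "infinite_play g \<alpha> \<nu> m F q v" "vs = map v [0..<k]"
  shows False
  using assms
proof (induction arbitrary: k)
  case (declares vs u)
  have "reachable g \<alpha> \<nu> m F (map q [0..<Suc k]) (map v [0..<Suc k])"
    using declares.prems unfolding infinite_play_def by blast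
  then show False using declares.hyps declares.prems by cases auto
next
  case (queries vs n)
  have "reachable g \<alpha> \<nu> m F (map q [0..<Suc k]) (map v [0..<Suc k])"
    using queries.prems unfolding infinite_play_def by blast
  then have "v k \<in> \<nu> m F [] vs" using queries.prems(1,3) by cases auto
  then show False using queries.IH[of "v k" "Suc k"] queries.prems by simp
qed

text \<open>
  From a position that is not won, a Nimue that never loses at once leaves Merlin a move to another
  position that is not won; iterating this gives an infinite play.
\<close>

lemma won_if_winning:
  assumes "winning f g \<alpha> \<nu>" "F \<in> f m"
  shows "won g \<alpha> m F []"
proof (rule ccontr)
  assume not_won: "\<not> won g \<alpha> m F []"
  define lost where
    "lost s \<longleftrightarrow> reachable g \<alpha> \<nu> m F (fst s) (snd s) \<and> \<not> won g \<alpha> m F (snd s)" for s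
  have next_pos: "\<exists>s'. lost s' \<and> (\<exists>n v. s' = (fst s @ [n], snd s @ [v]))" if P: "lost s" for s
  proof -
    obtain qs vs where s: "s = (qs, vs)" by (cases s)
    from P have r: "reachable g \<alpha> \<nu> m F qs vs" and nw: "\<not> won g \<alpha> m F vs" by (auto simp: s lost_def)
    from r have "no_immediate_loss g \<alpha> \<nu> m F qs vs" using assms unfolding winning_def by blast
    with nw obtain n where n: "\<alpha> m vs = Some (Query n)" "\<nu> m F (qs @ [n]) vs \<in> g n"
      by (auto simp: no_immediate_loss_def split: option.splits arthur_move.splits intro: won.declares)
    with nw obtain v where "v \<in> \<nu> m F (qs @ [n]) vs" "\<not> won g \<alpha> m F (vs @ [v])"
      by (blast intro: won.queries)
    with reachable.step[OF r n] show ?thesis by (auto simp: s lost_def)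
  qed
  then obtain nxt where nxt: "\<And>s. lost s \<Longrightarrow> lost (nxt s)"
      "\<And>s. lost s \<Longrightarrow> \<exists>n v. nxt s = (fst s @ [n], snd s @ [v])" by metis
  define S where "S k = (nxt ^^ k) ([], [])" for k
  have S: "lost (S k)" for k
    by (induction k) (use not_won reachable.start nxt(1) in \<open>auto simp: S_def lost_def\<close>)
  have "\<exists>n v. S (Suc k) = (fst (S k) @ [n], snd (S k) @ [v])" for k
    using nxt(2)[OF S[of k]] by (simp add: S_def)
  then obtain q v where qv: "\<And>k. S (Suc k) = (fst (S k) @ [q k], snd (S k) @ [v k])" by metis
  have "S k = (map q [0..<k], map v [0..<k])" for k by (induction k) (simp_all add: qv S_def[of 0])
  then have "infinite_play g \<alpha> \<nu> m F q v" unfolding infinite_play_def using S by (metis fst_conv lost_def snd_conv)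
  then show False using assms unfolding winning_def by blast
qed

text \<open>
  Nimue's moves need no computability, so a reduction is just a computable strategy for Arthur from
  which the initial positions are won.
\<close>

theorem reducible_iff_won:
  "reducible f g \<longleftrightarrow> (\<exists>\<alpha>. computable_strategy \<alpha> \<and> (\<forall>m. \<forall>F\<in>f m. won g \<alpha> m F []))"
proof
  show "reducible f g \<Longrightarrow> \<exists>\<alpha>. computable_strategy \<alpha> \<and> (\<forall>m. \<forall>F\<in>f m. won g \<alpha> m F [])"
    unfolding reducible_def using won_if_winning by blast
next
  assume "\<exists>\<alpha>. computable_strategy \<alpha> \<and> (\<forall>m. \<forall>F\<in>f m. won g \<alpha> m F [])"
  then obtain \<alpha> where \<alpha>: "computable_strategy \<alpha>" "\<And>m F. F \<in> f m \<Longrightarrow> won g \<alpha> m F []" by blast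
  define N where "N m F = (SOME \<nu>. won_by g \<alpha> \<nu> m F [])" for m F
  have N: "won_by g \<alpha> (N m F) m F []" if "F \<in> f m" for m F
    unfolding N_def by (rule someI_ex[OF won_imp_won_by[OF \<alpha>(2)[OF that]]])
  define \<nu> :: nimue_strategy where "\<nu> m F qs vs = N m F vs" for m F qs vs
  have "winning f g \<alpha> \<nu>"
    unfolding winning_def
  proof (intro allI ballI conjI impI)
    fix m F qs vs assume F: "F \<in> f m" and "reachable g \<alpha> \<nu> m F qs vs"
    from this(2) have "won_by g \<alpha> (N m F) m F vs"
    proof induction
      case start
      show ?case using N[OF F] .
    next
      case (step qs vs n v)
      from step(5) show ?case by cases (use step in \<open>auto simp: \<nu>_def\<close>)
    qed
    then show "no_immediate_loss g \<alpha> \<nu> m F qs vs"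
      by cases (auto simp: no_immediate_loss_def \<nu>_def)
  next
    fix m F assume "F \<in> f m"
    from N[OF this] have w: "won_by g \<alpha> (\<nu> m F []) m F []" by (simp add: \<nu>_def[abs_def])
    have "\<nu> m F qs vs = \<nu> m F [] vs" for qs vs by (simp add: \<nu>_def)
    then have False if "infinite_play g \<alpha> \<nu> m F q v" for q v
      by (rule no_infinite_play_if_won_by[where \<nu> = \<nu> and k = 0, OF w _ that]) simp
    then show "\<nexists>q v. infinite_play g \<alpha> \<nu> m F q v" by blast
  qed
  with \<alpha>(1) show "reducible f g" unfolding reducible_def by blast
qed

section \<open>Computable strategies\<close>

abbreviation zero_oracle :: "nat \<Rightarrow> nat" where "zero_oracle \<equiv> \<lambda>_. 0"

definition move_decode :: "nat \<Rightarrow> arthur_move" where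
  "move_decode k = (case sum_decode k of Inl u \<Rightarrow> Declare u | Inr n \<Rightarrow> Query n)"

lemma move_encode_decode [simp]: "move_encode (move_decode k) = k"
proof (cases "sum_decode k")
  case (Inl u)
  then show ?thesis unfolding move_decode_def using sum_decode_inverse[of k] by simp
next
  case (Inr n)
  then show ?thesis unfolding move_decode_def using sum_decode_inverse[of k] by simp
qed

lemma move_decode_encode [simp]: "move_decode (move_encode mv) = mv"
  by (cases mv) (simp_all add: move_decode_def)

lemma computable_strategy_iff:
  "computable_strategy \<alpha> \<longleftrightarrow>
     (\<exists>p. \<forall>m vs. run zero_oracle p \<langle>m, list_encode vs\<rangle> = map_option move_encode (\<alpha> m vs))"
proof -
  have "char_fun {} = zero_oracle" by (auto simp: char_fun_def)
  then have "partial_computable f \<longleftrightarrow> (\<exists>p. f = run zero_oracle p)" for f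
    unfolding partial_computable_def phi_def by (metis prog_decode_encode)
  then show ?thesis unfolding computable_strategy_def by metis
qed

text \<open>
  The strategies that are programmed explicitly below always have a next move.
\<close>

lemma computable_strategy_total:
  assumes "computable_in zero_oracle (\<lambda>z. move_encode (s (pfst z) (list_decode (psnd z))))"
  shows "computable_strategy (\<lambda>m vs. Some (s m vs))"
proof -
  from assms obtain p where "\<And>z. run zero_oracle p z = Some (move_encode (s (pfst z) (list_decode (psnd z))))"
    unfolding computable_in_def by blast
  then show ?thesis unfolding computable_strategy_iff by (intro exI[of _ p]) simp
qed

lemma move_encode_arith: "move_encode (Declare u) = u + u" "move_encode (Query n) = Suc (n + n)"
  by (simp_all add: sum_encode_def)

lemma move_decode_arith: "move_decode (u + u) = Declare u" "move_decode (Suc (n + n)) = Query n"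
  by (metis move_decode_encode move_encode_arith)+

lemma
  assumes "computable_strategy \<alpha>" "computable_in g m" "computable_in g l" "computable_in g a"
  shows semidecidable_declare:
      "semidecidable_in g (\<lambda>x. \<alpha> (m x) (list_decode (l x)) = Some (Declare (a x)))"
    and semidecidable_query:
      "semidecidable_in g (\<lambda>x. \<alpha> (m x) (list_decode (l x)) = Some (Query (a x)))"
proof -
  obtain p where p: "\<And>m vs. run zero_oracle p \<langle>m, list_encode vs\<rangle> = map_option move_encode (\<alpha> m vs)"
    using assms(1) computable_strategy_iff by blast
  have *: "\<alpha> k vs = Some mv \<longleftrightarrow>
      run zero_oracle (prog_decode (prog_encode p)) \<langle>k, list_encode vs\<rangle> = Some (move_encode mv)" for k vs mv
    unfolding prog_decode_encode p by (cases "\<alpha> k vs") (auto, metis move_decode_encode)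
  show "semidecidable_in g (\<lambda>x. \<alpha> (m x) (list_decode (l x)) = Some (Declare (a x)))"
    and "semidecidable_in g (\<lambda>x. \<alpha> (m x) (list_decode (l x)) = Some (Query (a x)))"
    unfolding * move_encode_arith list_decode_inverse
    by (intro semidecidable_run computable_intros assms)+
qed

section \<open>Reducibility is a preorder\<close>

lemma reducible_by_one_query:
  assumes "computable_in zero_oracle a" "computable_in zero_oracle b"
    and "\<And>m F. F \<in> f m \<Longrightarrow> \<exists>G\<in>g (a m). \<forall>v\<in>G. b v \<in> F"
  shows "reducible f g"
proof -
  define s where "s m vs = (case vs of [] \<Rightarrow> Query (a m) | v # _ \<Rightarrow> Declare (b v))" for m vs
  define \<alpha> :: arthur_strategy where "\<alpha> = (\<lambda>m vs. Some (s m vs))"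
  have "move_encode (s m (list_decode l)) =
      (if l = 0 then Suc (a m + a m) else b (pfst (l - 1)) + b (pfst (l - 1)))" for m l
  proof (cases l)
    case (Suc k)
    then show ?thesis
      using prod_decode_inverse[of k]
      by (cases "prod_decode k") (simp add: s_def move_encode_arith del: move_encode.simps)
  qed (simp add: s_def move_encode_arith del: move_encode.simps)
  then have "computable_in zero_oracle (\<lambda>z. move_encode (s (pfst z) (list_decode (psnd z))))"
    by (simp, intro computable_if_zero computable_intros
        computable_compose[OF assms(1)] computable_compose[OF assms(2)])
  then have "computable_strategy \<alpha>" unfolding \<alpha>_def by (rule computable_strategy_total)
  moreover have "won g \<alpha> m F []" if F: "F \<in> f m" for m F
  proof -
    obtain G where G: "G \<in> g (a m)" "\<And>v. v \<in> G \<Longrightarrow> b v \<in> F" using assms(3)[OF F] by blast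
    show ?thesis
      by (rule won.queries[where n = "a m" and G = G])
         (use G in \<open>auto simp: \<alpha>_def s_def intro: won.declares\<close>)
  qed
  ultimately show ?thesis unfolding reducible_iff_won by blast
qed

lemma reducible_refl: "reducible f f"
  by (rule reducible_by_one_query[OF computable_id computable_id]) blast

text \<open>
  Composing strategies: \<open>\<alpha>\<close> plays an outer game, and each of its queries is answered by an inner
  game played by \<open>\<beta>\<close>. The state consists of the answers \<open>ws\<close> obtained so far in the outer game, those
  \<open>us\<close> obtained in the current inner game, and the moves \<open>vs\<close> of Merlin that are still to be processed;
  the last argument is the move that the combined strategy makes once they are used up. The inner
  game starts afresh when its result has been passed to the outer game.
\<close>

inductive relay ::
  "arthur_strategy \<Rightarrow> arthur_strategy \<Rightarrow> nat \<Rightarrow> nat list \<Rightarrow> nat list \<Rightarrow> nat list \<Rightarrow> arthur_move \<Rightarrow> bool"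
  for \<alpha> \<beta> :: arthur_strategy and m :: nat where
  declares: "\<alpha> m ws = Some (Declare u) \<Longrightarrow> relay \<alpha> \<beta> m ws us vs (Declare u)"
| queries: "\<alpha> m ws = Some (Query n) \<Longrightarrow> \<beta> n us = Some (Query k) \<Longrightarrow> relay \<alpha> \<beta> m ws us [] (Query k)"
| answer: "\<alpha> m ws = Some (Query n) \<Longrightarrow> \<beta> n us = Some (Declare w) \<Longrightarrow> relay \<alpha> \<beta> m (ws @ [w]) [] vs mv
    \<Longrightarrow> relay \<alpha> \<beta> m ws us vs mv"
| resume: "\<alpha> m ws = Some (Query n) \<Longrightarrow> \<beta> n us = Some (Query k) \<Longrightarrow> relay \<alpha> \<beta> m ws (us @ [v]) vs mv
    \<Longrightarrow> relay \<alpha> \<beta> m ws us (v # vs) mv"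

lemma relay_deterministic:
  "relay \<alpha> \<beta> m ws us vs mv \<Longrightarrow> relay \<alpha> \<beta> m ws us vs mv' \<Longrightarrow> mv' = mv"
proof (induction arbitrary: mv' rule: relay.induct)
  case (declares ws u us vs)
  from declares(2,1) show ?case by cases auto
next
  case (queries ws n us k)
  from queries(3,1,2) show ?case by cases auto
next
  case (answer ws n us w vs mv)
  from answer(5,1,2,4) show ?case by cases auto
next
  case (resume ws n us k v vs mv)
  from resume(5,1,2,4) show ?case by cases auto
qed

lemma semidecidable_relay:
  assumes "computable_strategy \<alpha>" "computable_strategy \<beta>"
  shows "semidecidable_in g (\<lambda>z. relay \<alpha> \<beta> (pfst (pfst z)) [] [] (list_decode (psnd (pfst z))) (move_decode (psnd z)))"
proof -
  let ?d = list_decode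
  let ?j = "\<lambda>m ws us vs k. \<langle>m, \<langle>ws, \<langle>us, \<langle>vs, k\<rangle>\<rangle>\<rangle>\<rangle>"
  define Ax where "Ax t \<longleftrightarrow> (\<exists>m ws us vs.
      (\<exists>u. \<alpha> m (?d ws) = Some (Declare u) \<and> t = ?j m ws us vs (u + u)) \<or>
      (\<exists>n k. \<alpha> m (?d ws) = Some (Query n) \<and> \<beta> n (?d us) = Some (Query k) \<and> t = ?j m ws us 0 (Suc (k + k))))" for t
  define Rl where "Rl t y z \<longleftrightarrow> z = y \<and> (\<exists>m ws us vs mv n.
      (\<exists>w. \<alpha> m (?d ws) = Some (Query n) \<and> \<beta> n (?d us) = Some (Declare w) \<and>
         t = ?j m ws us vs mv \<and> y = ?j m (list_encode (?d ws @ [w])) 0 vs mv) \<or>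
      (\<exists>k v. \<alpha> m (?d ws) = Some (Query n) \<and> \<beta> n (?d us) = Some (Query k) \<and>
         t = ?j m ws us (Suc \<langle>v, vs\<rangle>) mv \<and> y = ?j m ws (list_encode (?d us @ [v])) vs mv))" for t y z
  have "derivable Ax Rl (?j m (list_encode ws) (list_encode us) (list_encode vs) (move_encode mv))"
    if "relay \<alpha> \<beta> m ws us vs mv" for m ws us vs mv
    using that
  proof induction
    case (declares ws u us vs)
    then have "\<alpha> m (?d (list_encode ws)) = Some (Declare u)" by simp
    then show ?case unfolding move_encode_arith
      by - (rule derivable.axiom, unfold Ax_def, blast)
  next
    case (queries ws n us k)
    then have "\<alpha> m (?d (list_encode ws)) = Some (Query n)" "\<beta> n (?d (list_encode us)) = Some (Query k)"
      by simp_all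
    then show ?case unfolding move_encode_arith list_encode.simps(1)
      by - (rule derivable.axiom, unfold Ax_def, blast)
  next
    case (answer ws n us w vs mv)
    then have "\<alpha> m (?d (list_encode ws)) = Some (Query n)" "\<beta> n (?d (list_encode us)) = Some (Declare w)"
      by simp_all
    then have "Rl (?j m (list_encode ws) (list_encode us) (list_encode vs) (move_encode mv))
        (?j m (list_encode (?d (list_encode ws) @ [w])) 0 (list_encode vs) (move_encode mv))
        (?j m (list_encode (?d (list_encode ws) @ [w])) 0 (list_encode vs) (move_encode mv))"
      unfolding Rl_def by blast
    then show ?case by (rule derivable.rule) (use answer(4) in simp_all)
  next
    case (resume ws n us k v vs mv)
    then have "\<alpha> m (?d (list_encode ws)) = Some (Query n)" "\<beta> n (?d (list_encode us)) = Some (Query k)"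
      by simp_all
    then have "Rl (?j m (list_encode ws) (list_encode us) (Suc \<langle>v, list_encode vs\<rangle>) (move_encode mv))
        (?j m (list_encode ws) (list_encode (?d (list_encode us) @ [v])) (list_encode vs) (move_encode mv))
        (?j m (list_encode ws) (list_encode (?d (list_encode us) @ [v])) (list_encode vs) (move_encode mv))"
      unfolding Rl_def by blast
    then show ?case unfolding list_encode.simps(2)
      by (rule derivable.rule) (use resume(4) in simp_all)
  qed
  from this[of _ "[]" "[]"]
  have complete: "derivable Ax Rl (?j m 0 0 vs k)" if "relay \<alpha> \<beta> m [] [] (?d vs) (move_decode k)" for m vs k
    using that by (metis list_decode_inverse list_encode.simps(1) move_encode_decode)
  have "relay \<alpha> \<beta> (pfst t) (?d (pfst (psnd t))) (?d (pfst (psnd (psnd t))))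
      (?d (pfst (psnd (psnd (psnd t))))) (move_decode (psnd (psnd (psnd (psnd t)))))"
    if "derivable Ax Rl t" for t
    using that
  proof induction
    case (axiom t)
    then show ?case unfolding Ax_def
      by (auto simp: move_decode_arith intro: relay.intros)
  next
    case (rule t y z)
    then show ?case unfolding Rl_def by (auto intro: relay.answer relay.resume)
  qed
  from this[of "?j m 0 0 vs k" for m vs k]
  have sound: "relay \<alpha> \<beta> m [] [] (?d vs) (move_decode k)" if "derivable Ax Rl (?j m 0 0 vs k)" for m vs k
    using that by simp
  have "semidecidable_in g (derivable Ax Rl)" unfolding Ax_def Rl_def
    by (intro semidecidable_derivable semidecidable_intros computable_intros computable_snoc
        semidecidable_declare semidecidable_query assms)
  then have "semidecidable_in g (\<lambda>z. derivable Ax Rl (?j (pfst (pfst z)) 0 0 (psnd (pfst z)) (psnd z)))"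
    by (rule semidecidable_compose) (intro computable_intros)
  then show ?thesis by (rule semidecidable_cong) (use sound complete in blast)
qed

text \<open>
  The last hypothesis says that the combined strategy, after reading \<open>vs\<close>, has the outer answers \<open>ws\<close>
  and a fresh inner game, expressed through all continuations so that no description of intermediate
  states is needed. The induction is on the won position of the outer game, and for each of its
  queries on the won position of the inner game.
\<close>

lemma won_relay:
  assumes \<gamma>: "\<And>vs mv. relay \<alpha> \<beta> m [] [] vs mv \<Longrightarrow> \<gamma> m vs = Some mv"
    and \<beta>: "\<And>n G. G \<in> g n \<Longrightarrow> won h \<beta> n G []"
    and "won g \<alpha> m F ws"
    and "\<And>rest mv. relay \<alpha> \<beta> m ws [] rest mv \<Longrightarrow> relay \<alpha> \<beta> m [] [] (vs @ rest) mv"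
  shows "won h \<gamma> m F vs"
  using assms(3,4)
proof (induction arbitrary: vs)
  case (declares ws u)
  have "\<gamma> m vs = Some (Declare u)"
    using \<gamma> declares.prems[OF relay.declares[of \<alpha> m _ _ \<beta>, OF declares.hyps(1)], of "[]"] by simp
  then show ?case using declares.hyps(2) by (rule won.declares)
next
  case (queries ws n G)
  note outer_IH = queries.IH
  have "won h \<gamma> m F vs" if "won h \<beta> n G us"
    "\<And>rest mv. relay \<alpha> \<beta> m ws us rest mv \<Longrightarrow> relay \<alpha> \<beta> m [] [] (vs @ rest) mv" for us vs
    using that
  proof (induction arbitrary: vs)
    case (declares us w)
    note outer = \<open>\<alpha> m ws = Some (Query n)\<close>
    show ?case
      using declares.prems relay.answer[of \<alpha> m _ _ \<beta>, OF outer declares.hyps(1)]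
      by - (rule outer_IH[OF declares.hyps(2)], blast)
  next
    case (queries us k K)
    note outer = \<open>\<alpha> m ws = Some (Query n)\<close>
    have "\<gamma> m vs = Some (Query k)"
      using \<gamma> queries.prems[OF relay.queries[of \<alpha> m _ _ \<beta>, OF outer queries.hyps(1)]] by simp
    moreover have "won h \<gamma> m F (vs @ [v])" if "v \<in> K" for v
    proof (rule queries.IH[OF that])
      fix rest mv assume "relay \<alpha> \<beta> m ws (us @ [v]) rest mv"
      from queries.prems[OF relay.resume[of \<alpha> m _ _ \<beta>, OF outer queries.hyps(1) this]]
      show "relay \<alpha> \<beta> m [] [] ((vs @ [v]) @ rest) mv" by simp
    qed
    ultimately show ?case using queries.hyps(2) by (blast intro: won.queries)
  qed
  from this[OF \<beta>[OF queries.hyps(2)] queries.prems] show ?case by blast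
qed

text \<open>
  The combined strategy is computed by searching for a derivation in \<open>relay\<close>, whose result is unique.
\<close>

theorem reducible_trans:
  assumes "reducible f g" "reducible g h"
  shows "reducible f h"
proof -
  obtain \<alpha> where \<alpha>: "computable_strategy \<alpha>" "\<And>m F. F \<in> f m \<Longrightarrow> won g \<alpha> m F []"
    using assms(1) unfolding reducible_iff_won by blast
  obtain \<beta> where \<beta>: "computable_strategy \<beta>" "\<And>m F. F \<in> g m \<Longrightarrow> won h \<beta> m F []"
    using assms(2) unfolding reducible_iff_won by blast
  define R where "R z k \<longleftrightarrow> relay \<alpha> \<beta> (pfst z) [] [] (list_decode (psnd z)) (move_decode k)" for z k
  have "semidecidable_in zero_oracle (\<lambda>z. R (pfst z) (psnd z))"
    unfolding R_def by (rule semidecidable_relay[OF \<alpha>(1) \<beta>(1)])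
  then obtain p where p: "\<And>z k. run zero_oracle p z = Some k \<Longrightarrow> R z k"
      "\<And>z k. R z k \<Longrightarrow> run zero_oracle p z \<noteq> None"
    using semidecidable_uniformization by blast
  define \<gamma> :: arthur_strategy where
    "\<gamma> m vs = map_option move_decode (run zero_oracle p \<langle>m, list_encode vs\<rangle>)" for m vs
  have "computable_strategy \<gamma>"
    unfolding computable_strategy_iff by (intro exI[of _ p]) (simp add: \<gamma>_def option.map_comp comp_def option.map_ident)
  moreover have \<gamma>: "\<gamma> m vs = Some mv" if "relay \<alpha> \<beta> m [] [] vs mv" for m vs mv
  proof -
    have "R \<langle>m, list_encode vs\<rangle> (move_encode mv)" using that by (simp add: R_def)
    then obtain k where k: "run zero_oracle p \<langle>m, list_encode vs\<rangle> = Some k" using p(2) by blast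
    from p(1)[OF this] have "relay \<alpha> \<beta> m [] [] vs (move_decode k)" by (simp add: R_def)
    with that have "move_decode k = mv" by (rule relay_deterministic)
    then show ?thesis by (simp add: \<gamma>_def k)
  qed
  moreover have "won h \<gamma> m F []" if "F \<in> f m" for m F
    by (rule won_relay[OF \<gamma> \<beta>(2) \<alpha>(2)[OF that]]) auto
  ultimately show ?thesis unfolding reducible_iff_won by blast
qed

section \<open>Reductions to partial functions\<close>

lemma T1_to_T3_eq: "T1_to_T3 g n = (case g n of None \<Rightarrow> {} | Some v \<Rightarrow> {{v}})"
  by (simp add: T1_to_T3_def T2_to_T3_def T1_to_T2_def split: option.splits)

text \<open>
  Against a partial function there is only one legal play, and whoever can enumerate the graph of
  the function can follow it. The relation \<open>S\<close> holds between \<open>m\<close> and the value declared in that play.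
\<close>

lemma simulate_T1_oracle:
  assumes "computable_strategy \<alpha>" "semidecidable_in h (\<lambda>z. g (pfst z) = Some (psnd z))"
  obtains S where "semidecidable_in h (\<lambda>z. S (pfst z) (psnd z))"
    "\<And>m y u. won (T1_to_T3 g) \<alpha> m {y} [] \<Longrightarrow> S m u \<longleftrightarrow> u = y"
proof -
  let ?d = list_decode
  define Ax where "Ax t \<longleftrightarrow> (\<exists>m vs u. \<alpha> m (?d vs) = Some (Declare u) \<and> t = \<langle>m, \<langle>vs, u\<rangle>\<rangle>)" for t
  define Rl where "Rl t y z \<longleftrightarrow> z = y \<and> (\<exists>m vs n v u. \<alpha> m (?d vs) = Some (Query n) \<and> g n = Some v \<and>
      t = \<langle>m, \<langle>vs, u\<rangle>\<rangle> \<and> y = \<langle>m, \<langle>list_encode (?d vs @ [v]), u\<rangle>\<rangle>)" for t y z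
  have "semidecidable_in h (derivable Ax Rl)"
    unfolding Ax_def Rl_def
    by (intro semidecidable_derivable semidecidable_intros computable_intros computable_snoc
        semidecidable_declare semidecidable_query assms semidecidable_compose2[where R = "\<lambda>x y. g x = Some y"])
  then have sd: "semidecidable_in h (\<lambda>z. derivable Ax Rl \<langle>pfst z, \<langle>0, psnd z\<rangle>\<rangle>)"
    by (rule semidecidable_compose) (intro computable_intros)
  have complete: "derivable Ax Rl \<langle>m, \<langle>list_encode vs, y\<rangle>\<rangle>" if "won (T1_to_T3 g) \<alpha> m {y} vs" for m y vs
    using that
  proof induction
    case (declares vs u)
    then have "\<alpha> m (?d (list_encode vs)) = Some (Declare y)" by simp
    then show ?case by - (rule derivable.axiom, unfold Ax_def, blast)
  next
    case (queries vs n G)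
    then obtain v where v: "g n = Some v" "G = {v}" by (auto simp: T1_to_T3_eq split: option.splits)
    have "\<alpha> m (?d (list_encode vs)) = Some (Query n)" using queries by simp
    with v(1) have "Rl \<langle>m, \<langle>list_encode vs, y\<rangle>\<rangle> \<langle>m, \<langle>list_encode (?d (list_encode vs) @ [v]), y\<rangle>\<rangle>
        \<langle>m, \<langle>list_encode (?d (list_encode vs) @ [v]), y\<rangle>\<rangle>"
      unfolding Rl_def by blast
    then show ?case by (rule derivable.rule) (use queries.IH v(2) in simp_all)
  qed
  have sound: "psnd (psnd t) = y"
    if "derivable Ax Rl t" "won (T1_to_T3 g) \<alpha> (pfst t) {y} (?d (pfst (psnd t)))" for t y
    using that
  proof induction
    case (axiom t)
    from axiom(2,1) show ?case by cases (auto simp: Ax_def)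
  next
    case (rule t t' t'')
    from rule(1) obtain m vs n v u where t: "\<alpha> m (?d vs) = Some (Query n)" "g n = Some v"
        "t = \<langle>m, \<langle>vs, u\<rangle>\<rangle>" "t' = \<langle>m, \<langle>list_encode (?d vs @ [v]), u\<rangle>\<rangle>"
      unfolding Rl_def by blast
    from rule(6) have "won (T1_to_T3 g) \<alpha> m {y} (?d vs @ [v])"
      by cases (use t in \<open>auto simp: T1_to_T3_eq\<close>)
    with rule(4) t show ?case by simp
  qed
  have "derivable Ax Rl \<langle>m, \<langle>0, u\<rangle>\<rangle> \<longleftrightarrow> u = y" if "won (T1_to_T3 g) \<alpha> m {y} []" for m y u
    using complete[OF that] sound[of "\<langle>m, \<langle>0, u\<rangle>\<rangle>" y] that by auto
  with sd show thesis by (rule that)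
qed

lemma computable_if_reducible_T1:
  assumes "reducible (T1_to_T3 f) (T1_to_T3 g)" "semidecidable_in h (\<lambda>z. g (pfst z) = Some (psnd z))"
    and "computable_in h a" "\<And>x. f (a x) = Some (c x)"
  shows "computable_in h c"
proof -
  from assms(1) obtain \<alpha> where \<alpha>: "computable_strategy \<alpha>"
      "\<And>m F. F \<in> T1_to_T3 f m \<Longrightarrow> won (T1_to_T3 g) \<alpha> m F []"
    unfolding reducible_iff_won by blast
  obtain S where S: "semidecidable_in h (\<lambda>z. S (pfst z) (psnd z))"
    "\<And>m y u. won (T1_to_T3 g) \<alpha> m {y} [] \<Longrightarrow> S m u \<longleftrightarrow> u = y"
    using simulate_T1_oracle[OF \<alpha>(1) assms(2)] by blast
  have "semidecidable_in h (\<lambda>z. S (a (pfst z)) (psnd z))"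
    by (intro semidecidable_compose2[OF S(1)] computable_compose[OF assms(3)] computable_intros)
  moreover have "S (a x) y \<longleftrightarrow> c x = y" for x y
    using S(2)[OF \<alpha>(2), of "c x" "a x" y] assms(4)[of x] by (auto simp: T1_to_T3_eq)
  ultimately have "semidecidable_in h (\<lambda>z. c (pfst z) = psnd z)" by simp
  then show ?thesis by (rule computable_if_semidecidable_graph)
qed

lemma T0_to_T3_eq: "T0_to_T3 g n = {{g n}}"
  by (simp add: T0_to_T3_def T1_to_T3_eq T0_to_T1_def)

text \<open>
  Arthur ignores which questions the program would ask. He queries the oracle at \<open>0, 1, 2, \<dots>\<close> in turn,
  and having received \<open>k\<close> answers he makes a single test: he reads \<open>k\<close> as \<open>(l, (y, w))\<close> and checks
  whether \<open>w\<close> witnesses that the program yields \<open>y\<close> from the first \<open>l\<close> answers. There are at least \<open>l\<close>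
  answers, because \<open>l \<le> k\<close>. By the use principle some test succeeds.
\<close>

lemma reducible_T0_if_computable:
  assumes "computable_in g f"
  shows "reducible (T0_to_T3 f) (T0_to_T3 g)"
proof -
  obtain p where p: "\<And>x. run g p x = Some (f x)" using assms unfolding computable_in_def by blast
  define Orc where "Orc c n v \<longleftrightarrow> n < length (list_decode c) \<and> list_decode c ! n = v" for c n v
  have "semidecidable_in zero_oracle (evaluates Orc)"
    unfolding Orc_def by (intro semidecidable_evaluates semidecidable_nth computable_intros)
  then obtain r where r: "computable_in zero_oracle r" "\<And>j. evaluates Orc j \<longleftrightarrow> (\<exists>w. r \<langle>j, w\<rangle> = 0)"
    unfolding semidecidable_in_def by blast
  define prefix where
    "prefix l k = list_encode (map (\<lambda>i. pfst (list_encode (drop i (list_decode l)) - 1)) [0..<k])" for l k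
  have "pfst (list_encode (drop i vs) - 1) = vs ! i" if "i < length vs" for i vs
    using Cons_nth_drop_Suc[OF that, symmetric] by simp
  then have prefix: "prefix (list_encode (map g [0..<k])) l = list_encode (map g [0..<l])" if "l \<le> k" for k l
    using that unfolding prefix_def by (intro arg_cong[of _ _ list_encode] map_cong) auto
  define fail where "fail m l = (let k = length (list_decode l) in
      r \<langle>eval_j (prefix l (pfst k)) (prog_encode p) m (pfst (psnd k)), psnd (psnd k)\<rangle>)" for m l
  define s where "s m vs = (if fail m (list_encode vs) = 0 then Declare (pfst (psnd (length vs)))
      else Query (length vs))" for m vs
  define \<alpha> :: arthur_strategy where "\<alpha> = (\<lambda>m vs. Some (s m vs))"
  have c_prefix: "computable_in zero_oracle (\<lambda>x. prefix (l x) (k x))"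
    if "computable_in zero_oracle l" "computable_in zero_oracle k" for l k
    unfolding prefix_def
    by (intro computable_map_upt that computable_intros computable_drop computable_compose[OF that(1)])
  have c_fail: "computable_in zero_oracle (\<lambda>z. fail (pfst z) (psnd z))"
    unfolding fail_def Let_def
    by (intro computable_compose[OF r(1)] computable_intros c_prefix computable_length)
  have "move_encode (s m (list_decode l)) = (let k = length (list_decode l) in
      if fail m l = 0 then pfst (psnd k) + pfst (psnd k) else Suc (k + k))" for m l
    by (simp add: s_def Let_def move_encode_arith del: move_encode.simps)
  then have "computable_in zero_oracle (\<lambda>z. move_encode (s (pfst z) (list_decode (psnd z))))"
    unfolding Let_def
    by (simp, intro computable_if_zero c_fail computable_intros computable_length)
  then have "computable_strategy \<alpha>" unfolding \<alpha>_def by (rule computable_strategy_total)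
  moreover have "won (T0_to_T3 g) \<alpha> m {f m} []" for m
  proof -
    have sound: "pfst (psnd k) = f m" if "fail m (list_encode (map g [0..<k])) = 0" for k
    proof -
      have "pfst k \<le> k" by (metis le_prod_encode_1 prod.collapse prod_decode_inverse)
      with that have "r \<langle>eval_j (list_encode (map g [0..<pfst k])) (prog_encode p) m (pfst (psnd k)), psnd (psnd k)\<rangle> = 0"
        by (simp add: fail_def Let_def prefix)
      then have "evaluates Orc (eval_j (list_encode (map g [0..<pfst k])) (prog_encode p) m (pfst (psnd k)))"
        using r(2) by blast
      from evaluates_sound[OF this, of g] show ?thesis by (auto simp: Orc_def p)
    qed
    obtain l where "\<And>c. (\<forall>n<l. Orc c n (g n)) \<Longrightarrow> evaluates Orc (eval_j c (prog_encode p) m (f m))"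
      using eventually_happens[OF evaluates_complete[OF p, of Orc m]] by auto
    then have "evaluates Orc (eval_j (list_encode (map g [0..<l])) (prog_encode p) m (f m))"
      by (simp add: Orc_def)
    then obtain w where w: "r \<langle>eval_j (list_encode (map g [0..<l])) (prog_encode p) m (f m), w\<rangle> = 0"
      using r(2) by blast
    define K where "K = \<langle>l, \<langle>f m, w\<rangle>\<rangle>"
    have "l \<le> K" unfolding K_def by (rule le_prod_encode_1)
    moreover have "pfst K = l" "pfst (psnd K) = f m" "psnd (psnd K) = w" by (simp_all add: K_def)
    ultimately have K: "fail m (list_encode (map g [0..<K])) = 0"
      using w by (simp add: fail_def Let_def prefix)
    have won_declares: "won (T0_to_T3 g) \<alpha> m {f m} (map g [0..<k])"
      if "fail m (list_encode (map g [0..<k])) = 0" for k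
      using that sound[OF that] by (intro won.declares[of \<alpha> m _ "f m"]) (simp_all add: \<alpha>_def s_def)
    have "won (T0_to_T3 g) \<alpha> m {f m} (map g [0..<0])"
    proof (rule inc_induct[of 0 K "\<lambda>k. won (T0_to_T3 g) \<alpha> m {f m} (map g [0..<k])"])
      show "0 \<le> K" by simp
      show "won (T0_to_T3 g) \<alpha> m {f m} (map g [0..<K])" by (rule won_declares[OF K])
    next
      fix k assume IH: "won (T0_to_T3 g) \<alpha> m {f m} (map g [0..<Suc k])"
      show "won (T0_to_T3 g) \<alpha> m {f m} (map g [0..<k])"
      proof (cases "fail m (list_encode (map g [0..<k])) = 0")
        case False
        then have "\<alpha> m (map g [0..<k]) = Some (Query k)" by (simp add: \<alpha>_def s_def)
        then show ?thesis
          by (rule won.queries[where G = "{g k}"]) (use IH in \<open>simp_all add: T0_to_T3_eq\<close>)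
      qed (rule won_declares)
    qed
    then show ?thesis by simp
  qed
  ultimately show ?thesis unfolding reducible_iff_won T0_to_T3_eq by blast
qed

theorem reducible_T0_iff_computable: "reducible (T0_to_T3 f) (T0_to_T3 g) \<longleftrightarrow> computable_in g f"
proof
  assume r: "reducible (T0_to_T3 f) (T0_to_T3 g)"
  have "semidecidable_in g (\<lambda>z. T0_to_T1 g (pfst z) = Some (psnd z))"
    unfolding T0_to_T1_def option.inject
    by (intro semidecidable_intros computable_intros computable_compose[OF computable_oracle])
  then show "computable_in g f"
    using computable_if_reducible_T1[OF r[unfolded T0_to_T3_def] _ computable_id] by (simp add: T0_to_T1_def)
qed (rule reducible_T0_if_computable)

section \<open>The sets of programs deciding between 0 and 1\<close>

lemma mem_H_iff: "e \<in> H i A \<longleftrightarrow> run (char_fun A) (prog_decode e) 0 = Some i"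
  by (simp add: H_def phi_def)

lemma semidecidable_H:
  assumes "computable_in (char_fun A) e"
  shows "semidecidable_in (char_fun A) (\<lambda>x. e x \<in> H i A)"
  unfolding mem_H_iff by (intro semidecidable_run computable_oracle assms computable_intros)

primrec const_prog :: "nat \<Rightarrow> prog" where
  "const_prog 0 = PZero"
| "const_prog (Suc n) = PComp PSucc (const_prog n)"

lemma run_const_prog [simp]: "run g (const_prog n) x = Some n"
  by (induction n) simp_all

definition ask :: "nat \<Rightarrow> nat" where
  "ask n = prog_encode (PComp POracle (const_prog n))"

text \<open>
  The primitive recursion with values \<open>1\<close> at \<open>0\<close> and \<open>0\<close> at successors computes \<open>1 - n\<close> from \<open>(0, n)\<close>.
\<close>

definition ask_not :: "nat \<Rightarrow> nat" where
  "ask_not n = prog_encode (PComp (PRec (const_prog 1) PZero) (PPair PZero (PComp POracle (const_prog n))))"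

lemma ask_mem_H_iff: "ask n \<in> H i A \<longleftrightarrow> char_fun A n = i"
  by (simp add: mem_H_iff ask_def)

lemma ask_not_mem_H_iff: "ask_not n \<in> H i A \<longleftrightarrow> 1 - char_fun A n = i"
  by (simp add: mem_H_iff ask_not_def char_fun_def)

lemma computable_ask: "computable_in g f \<Longrightarrow> computable_in g (\<lambda>x. ask (f x))"
proof -
  assume f: "computable_in g f"
  have "ask n = 6 + 4 * \<langle>4, rec_nat 0 (\<lambda>_ r. 6 + 4 * \<langle>1, r\<rangle>) n\<rangle>" for n
  proof -
    have "prog_encode (const_prog n) = rec_nat 0 (\<lambda>_ r. 6 + 4 * \<langle>1, r\<rangle>) n" by (induction n) simp_all
    then show ?thesis by (simp add: ask_def)
  qed
  then show ?thesis by (simp only:) (intro computable_intros computable_rec f)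
qed

lemma computable_ask_not:
  assumes "computable_in g f"
  shows "computable_in g (\<lambda>x. ask_not (f x))"
proof -
  have "ask_not n = 6 + 4 * \<langle>prog_encode (PRec (const_prog 1) PZero), 5 + 4 * \<langle>0, ask n\<rangle>\<rangle>" for n
    by (simp add: ask_not_def ask_def)
  then show ?thesis by (simp only:) (intro computable_intros computable_ask assms)
qed

lemma translate_programs:
  assumes "computable_in (char_fun A) (char_fun B)"
  obtains s where "\<And>g. computable_in g s" "\<And>e i. s e \<in> H i A \<longleftrightarrow> e \<in> H i B"
proof -
  obtain q where q: "\<And>x. run (char_fun A) q x = Some (char_fun B x)"
    using assms unfolding computable_in_def by blast
  show thesis
    by (rule that[OF computable_replace_oracle[of _ q]]) (simp add: mem_H_iff run_replace_oracle[of _ q, OF q])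
qed

abbreviation c_oracle :: "nat set \<Rightarrow> T3_oracle" where
  "c_oracle A \<equiv> basic_to_T3 {H 0 A, H 1 A}"

abbreviation d_oracle :: "nat set \<Rightarrow> T3_oracle" where
  "d_oracle A \<equiv> T1_to_T3 (decoding_oracle (H 0 A) (H 1 A))"

lemma reducible_c_oracle_if_computable:
  assumes "computable_in (char_fun A) (char_fun B)"
  shows "reducible (c_oracle A) (c_oracle B)"
proof -
  obtain s where "computable_in zero_oracle s" "\<And>e i. s e \<in> H i A \<longleftrightarrow> e \<in> H i B"
    using translate_programs[OF assms] by metis
  then show ?thesis
    by (intro reducible_by_one_query[where a = "\<lambda>_. 0" and b = s] computable_const)
       (auto simp: basic_to_T3_def)
qed

lemma reducible_d_oracle_iff_computable:
  "reducible (d_oracle B) (d_oracle A) \<longleftrightarrow> computable_in (char_fun A) (char_fun B)"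
proof
  assume r: "reducible (d_oracle B) (d_oracle A)"
  have "decoding_oracle (H 0 A) (H 1 A) e = Some i \<longleftrightarrow> (e \<in> H 0 A \<and> i = 0) \<or> (e \<in> H 1 A \<and> i = 1)" for e i
    by (auto simp: decoding_oracle_def mem_H_iff)
  then have "semidecidable_in (char_fun A) (\<lambda>z. decoding_oracle (H 0 A) (H 1 A) (pfst z) = Some (psnd z))"
    by (simp only:) (intro semidecidable_intros semidecidable_H computable_intros)
  moreover have "decoding_oracle (H 0 B) (H 1 B) (ask n) = Some (char_fun B n)" for n
    by (simp add: decoding_oracle_def ask_mem_H_iff char_fun_def)
  ultimately show "computable_in (char_fun A) (char_fun B)"
    by (intro computable_if_reducible_T1[OF r _ computable_ask[OF computable_id]])
next
  assume "computable_in (char_fun A) (char_fun B)"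
  then obtain s where "computable_in zero_oracle s" "\<And>e i. s e \<in> H i A \<longleftrightarrow> e \<in> H i B"
    using translate_programs by metis
  then show "reducible (d_oracle B) (d_oracle A)"
    by (intro reducible_by_one_query[where a = s and b = "\<lambda>v. v"] computable_id)
       (auto simp: T1_to_T3_eq decoding_oracle_def split: if_splits)
qed

section \<open>Coding reductions yield Turing reductions\<close>

text \<open>
  The game is started at \<open>0\<close>; a basic oracle has the same targets at every initial number.
\<close>

inductive forced :: "arthur_strategy \<Rightarrow> nat set \<Rightarrow> nat list \<Rightarrow> bool"
  for \<alpha> :: arthur_strategy and U :: "nat set" where
  declares: "\<alpha> 0 vs = Some (Declare u) \<Longrightarrow> u \<in> U \<Longrightarrow> forced \<alpha> U vs"
| queries: "\<alpha> 0 vs = Some (Query k) \<Longrightarrow> forced \<alpha> U (vs @ [ask n]) \<Longrightarrow> forced \<alpha> U (vs @ [ask_not n])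
    \<Longrightarrow> forced \<alpha> U vs"

lemma semidecidable_forced:
  assumes "computable_strategy \<alpha>" "semidecidable_in g (\<lambda>u. u \<in> U)" "computable_in g l"
  shows "semidecidable_in g (\<lambda>x. forced \<alpha> U (list_decode (l x)))"
proof -
  let ?d = list_decode
  define Ax where "Ax t \<longleftrightarrow> (\<exists>u. \<alpha> 0 (?d t) = Some (Declare u) \<and> u \<in> U)" for t
  define Rl where "Rl t y z \<longleftrightarrow> (\<exists>k n. \<alpha> 0 (?d t) = Some (Query k) \<and>
      y = list_encode (?d t @ [ask n]) \<and> z = list_encode (?d t @ [ask_not n]))" for t y z
  have "semidecidable_in g (derivable Ax Rl)"
    unfolding Ax_def Rl_def
    by (intro semidecidable_derivable semidecidable_intros computable_intros computable_snoc computable_ask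
        computable_ask_not semidecidable_declare semidecidable_query assms(1) semidecidable_compose[OF assms(2)])
  then have "semidecidable_in g (\<lambda>x. derivable Ax Rl (l x))"
    using assms(3) by (rule semidecidable_compose)
  moreover have "forced \<alpha> U (?d t)" if "derivable Ax Rl t" for t
    using that by induction (auto simp: Ax_def Rl_def intro: forced.intros)
  moreover have "derivable Ax Rl (list_encode vs)" if "forced \<alpha> U vs" for vs
    using that
  proof induction
    case (declares vs u)
    then show ?case by - (rule derivable.axiom, simp add: Ax_def)
  next
    case (queries vs k n)
    have "Rl (list_encode vs) (list_encode (vs @ [ask n])) (list_encode (vs @ [ask_not n]))"
      using queries.hyps(1) by (auto simp: Rl_def)
    then show ?case using queries.IH by (rule derivable.rule)
  qed
  ultimately show ?thesis by (elim semidecidable_cong) (metis list_decode_inverse)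
qed

text \<open>
  Merlin follows the tree that witnesses \<open>forced\<close>; at each query one of the two answers it provides
  lies in the set that Nimue has chosen.
\<close>

lemma forced_meets_target:
  assumes "forced \<alpha> U vs" "won (c_oracle B) \<alpha> 0 F vs"
  shows "F \<inter> U \<noteq> {}"
  using assms
proof induction
  case (declares vs u)
  from declares(3,1,2) show ?case by cases auto
next
  case (queries vs k n)
  from queries.prems obtain G where G: "G \<in> {H 0 B, H 1 B}"
      "\<And>v. v \<in> G \<Longrightarrow> won (c_oracle B) \<alpha> 0 F (vs @ [v])"
    by cases (use queries.hyps in \<open>auto simp: basic_to_T3_def\<close>)
  have "ask n \<in> G \<or> ask_not n \<in> G"
    using G(1) by (cases "n \<in> B") (auto simp: ask_mem_H_iff ask_not_mem_H_iff char_fun_def)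
  then show ?case using G(2) queries.IH by blast
qed

text \<open>
  If no \<open>n\<close> extends the tree at a query that Nimue answers by \<open>H j B\<close>, then \<open>ask n\<close> leads to a
  forced position iff \<open>B(n) = j\<close>, and \<open>ask_not n\<close> does iff \<open>B(n) = 1 - j\<close>. One of the two can be
  found with oracle \<open>A\<close>.
\<close>

lemma forced_if_won:
  assumes "computable_strategy \<alpha>" "semidecidable_in (char_fun A) (\<lambda>u. u \<in> U)"
    and "\<not> computable_in (char_fun A) (char_fun B)"
    and "won (c_oracle B) \<alpha> 0 U vs"
  shows "forced \<alpha> U vs"
  using assms(4)
proof induction
  case (declares vs u)
  then show ?case by (rule forced.declares)
next
  case (queries vs k G)
  from queries.hyps(2) obtain j where j: "G = H j B" "j \<le> 1" by (auto simp: basic_to_T3_def)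
  show ?case
  proof (rule ccontr)
    assume "\<not> forced \<alpha> U vs"
    then have one: "\<not> (forced \<alpha> U (vs @ [ask n]) \<and> forced \<alpha> U (vs @ [ask_not n]))" for n
      using forced.queries queries.hyps(1) by blast
    have xor: "(char_fun B n = j) \<noteq> (1 - char_fun B n = j)" for n
      using j(2) by (auto simp: char_fun_def)
    have f: "forced \<alpha> U (vs @ [ask n]) \<longleftrightarrow> char_fun B n = j"
      "forced \<alpha> U (vs @ [ask_not n]) \<longleftrightarrow> 1 - char_fun B n = j" for n
      using one[of n] xor[of n] queries.IH[of "ask n"] queries.IH[of "ask_not n"]
      unfolding j(1) ask_mem_H_iff ask_not_mem_H_iff by blast+
    \<comment> \<open>The redundant coding and decoding matches the form of \<open>semidecidable_forced\<close>.\<close>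
    have "char_fun B n = i \<longleftrightarrow> (forced \<alpha> U (list_decode (list_encode (list_decode (list_encode vs) @ [ask n]))) \<and> i = j) \<or>
        (forced \<alpha> U (list_decode (list_encode (list_decode (list_encode vs) @ [ask_not n]))) \<and> i = 1 - j)" for n i
      using j(2) unfolding list_encode_inverse f by (auto simp: char_fun_def)
    then have "semidecidable_in (char_fun A) (\<lambda>z. char_fun B (pfst z) = psnd z)"
      by (simp only:) (intro semidecidable_disj semidecidable_conj semidecidable_eq semidecidable_forced
          computable_snoc computable_intros computable_ask computable_ask_not assms(1,2))
    then show False using computable_if_semidecidable_graph assms(3) by blast
  qed
qed

text \<open>
  For \<open>F = H 1 A\<close> Merlin can force a declaration in \<open>H 0 A\<close>, as the initial position is also won for
  the target \<open>H 0 A\<close>.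
\<close>

theorem reducible_c_oracle_iff_computable:
  "reducible (c_oracle A) (c_oracle B) \<longleftrightarrow> computable_in (char_fun A) (char_fun B)"
proof
  assume "reducible (c_oracle A) (c_oracle B)"
  then obtain \<alpha> where \<alpha>: "computable_strategy \<alpha>"
      "won (c_oracle B) \<alpha> 0 (H 0 A) []" "won (c_oracle B) \<alpha> 0 (H 1 A) []"
    unfolding reducible_iff_won by (auto simp: basic_to_T3_def)
  show "computable_in (char_fun A) (char_fun B)"
  proof (rule ccontr)
    assume "\<not> computable_in (char_fun A) (char_fun B)"
    then have "forced \<alpha> (H 0 A) []"
      by (rule forced_if_won[OF \<alpha>(1) semidecidable_H[OF computable_id] _ \<alpha>(2)])
    from forced_meets_target[OF this \<alpha>(3)] show False by (auto simp: mem_H_iff)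
  qed
qed (rule reducible_c_oracle_if_computable)

section \<open>Degrees\<close>

lemma degree_le_iff: "T3_degree f \<preceq> T3_degree g \<longleftrightarrow> reducible f g"
  unfolding degree_le_def T3_degree_def using reducible_refl reducible_trans by blast

lemma T3_degree_eq_iff: "T3_degree f = T3_degree g \<longleftrightarrow> reducible f g \<and> reducible g f"
proof
  assume "T3_degree f = T3_degree g"
  then have "g \<in> T3_degree f" by (simp add: T3_degree_def reducible_refl)
  then show "reducible f g \<and> reducible g f" by (simp add: T3_degree_def)
next
  assume "reducible f g \<and> reducible g f"
  then show "T3_degree f = T3_degree g" unfolding T3_degree_def using reducible_trans by blast
qed

text \<open>
  A total function is Turing equivalent to its graph.
\<close>

lemma T0_degrees_eq: "T0_degrees = range turing_degree"
proof -
  have "\<exists>A. T3_degree (T0_to_T3 g) = turing_degree A" for g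
  proof -
    define A where "A = {z. g (pfst z) = psnd z}"
    have "char_fun A z = (if (g (pfst z) - psnd z) + (psnd z - g (pfst z)) = 0 then 1 else 0)" for z
      by (auto simp: char_fun_def A_def)
    then have "char_fun A = (\<lambda>z. if (g (pfst z) - psnd z) + (psnd z - g (pfst z)) = 0 then 1 else 0)"
      by blast
    moreover have "computable_in g \<dots>"
      by (intro computable_if_zero computable_intros computable_compose[OF computable_oracle])
    ultimately have "computable_in g (char_fun A)" by simp
    moreover have "computable_in (char_fun A) g"
    proof (rule computable_if_semidecidable_graph)
      have "g (pfst z) = psnd z \<longleftrightarrow> char_fun A z = 1" for z by (simp add: A_def char_fun_def)
      then show "semidecidable_in (char_fun A) (\<lambda>z. g (pfst z) = psnd z)"
        by (simp only:) (intro semidecidable_intros computable_intros computable_oracle)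
    qed
    ultimately have "T3_degree (T0_to_T3 g) = turing_degree A"
      by (simp add: turing_degree_def T3_degree_eq_iff reducible_T0_iff_computable)
    then show ?thesis ..
  qed
  then show ?thesis unfolding T0_degrees_def turing_degree_def by blast
qed

theorem theorem5p8:
  shows "(\<forall>A B :: nat set.
            (c_tilde A \<preceq> c_tilde B \<longleftrightarrow> turing_degree B \<preceq> turing_degree A)
          \<and> (c_tilde A \<preceq> c_tilde B \<longleftrightarrow> d_tilde B \<preceq> d_tilde A))
       \<and> (\<forall>A :: nat set. coT (turing_degree A) = c_tilde A)
       \<and> coT ` T0_degrees \<subseteq> T3_degrees
       \<and> inj_on coT T0_degrees
       \<and> (\<forall>a\<in>T0_degrees. \<forall>b\<in>T0_degrees. coT a \<preceq> coT b \<longleftrightarrow> b \<preceq> a)"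
proof -
  have c: "c_tilde A \<preceq> c_tilde B \<longleftrightarrow> computable_in (char_fun A) (char_fun B)" for A B
    by (simp add: c_tilde_def coding_degree_def degree_le_iff reducible_c_oracle_iff_computable del: One_nat_def)
  have d: "d_tilde B \<preceq> d_tilde A \<longleftrightarrow> computable_in (char_fun A) (char_fun B)" for A B
    by (simp add: d_tilde_def decoding_degree_def degree_le_iff reducible_d_oracle_iff_computable del: One_nat_def)
  have t: "turing_degree B \<preceq> turing_degree A \<longleftrightarrow> computable_in (char_fun A) (char_fun B)" for A B
    by (simp add: turing_degree_def degree_le_iff reducible_T0_iff_computable)
  have eq: "turing_degree A = turing_degree B \<longleftrightarrow> c_tilde A = c_tilde B" for A B
    by (auto simp: turing_degree_def c_tilde_def coding_degree_def T3_degree_eq_iff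
        reducible_T0_iff_computable reducible_c_oracle_iff_computable simp del: One_nat_def)
  have coT: "coT (turing_degree A) = c_tilde A" for A
    unfolding coT_def using eq by (intro the_equality) auto
  have "coT ` T0_degrees \<subseteq> T3_degrees"
    by (auto simp: T0_degrees_eq coT c_tilde_def coding_degree_def T3_degrees_def)
  moreover have "inj_on coT T0_degrees"
    unfolding inj_on_def T0_degrees_eq using eq by (force simp: coT)
  ultimately show ?thesis by (auto simp: T0_degrees_eq coT c d t)
qed

end
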